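(* Suppose $\omega$ is nonnegative and bounded from above, with $\mathbb{E}(\omega)>0$. For any $r\in[1,\frac{\pi^2}{8}]$ and any positive integer $L$, there is $k=k(r,L)$ such that, with this choice of $k$ for each $L$, $$\lim_{L\to\infty}\frac{\lambda_1}{\min\frac1u}=r$$ with probability one. In particular, for any sequence $k=k(L)$ satisfying $\lim_{L\to\infty}kL^2=0$, one has $$\lim_{L\to\infty}\frac{\lambda_1}{\min\frac1u}=\frac{\pi^2}{8}$$ with probability one; and for any sequence $k=k(L)$ satisfying $$\lim_{L\to\infty}kL^2=\infty\quad\text{and}\quad\limsup_{L\to\infty}kL^{2-\beta}<\infty$$ for some $0<\beta<1/4$, one has $$\lim_{L\to\infty}\frac{\lambda_1}{\min\frac1u}=1$$ with probability one.
   Context: Let $\{\omega_j\}_{j\in\mathbb{Z}}$ be nonnegative i.i.d. real random variables on a probability space, with $\omega$ denoting a random variable with their common distribution. Let $\chi$ be the characteristic function of $[0,1)$ and $V_\omega(x)=\sum_{j\in\mathbb{Z}}\omega_j\chi(x-j)$, $x\in\mathbb{R}$. For a positive integer $L$ and $k\ge 0$ (deterministic, possibly depending on $L$) let $H=-\Delta+kV_\omega$ on $\Omega=(0,L)$ with Dirichlet boundary conditions, where $\Delta=d^2/dx^2$. $\lambda_1$ denotes the smallest (ground state) eigenvalue of $H$ on $\Omega$. $u$ (the landscape function) denotes the unique solution of $Hu=1$ on $\Omega$ with $u(0)=u(L)=0$; it is strictly positive on $(0,L)$. $\min\frac1u$ is the minimum of $1/u$ over $\Omega$, i.e. $1/\max_{[0,L]}u$.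 Both $\lambda_1$ and $u$ depend on $L,k$ and $\omega$. Limits $L\to\infty$ are over positive integers, for a fixed realization of the whole sequence $(\omega_j)$. *)

theory Defs
  imports "HOL-Probability.Probability"
begin

definition random_potential :: "(int \<Rightarrow> real) \<Rightarrow> real \<Rightarrow> real" where
  "random_potential w x = (\<Sum>\<^sub>\<infinity>j\<in>UNIV. w j * indicator {0..<1} (x - of_int j))"

text \<open>
  The function \<open>u\<close> belongs to the Sobolev space of order 2 on the interval from 0 to \<open>L\<close>
  and \<open>g\<close> represents its second derivative: in dimension one this means that \<open>u\<close> is
  continuously differentiable up to the boundary and that its derivative is a primitive of
  the square-integrable function \<open>g\<close>.
\<close>

definition sobolev2_second_deriv :: "real \<Rightarrow> (real \<Rightarrow> real) \<Rightarrow> (real \<Rightarrow> real) \<Rightarrow> bool" where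
  "sobolev2_second_deriv L u g \<longleftrightarrow>
     set_borel_measurable lborel {0..L} g \<and>
     set_integrable lborel {0..L} (\<lambda>x. (g x)\<^sup>2) \<and>
     (\<exists>v. \<forall>x\<in>{0..L}. (u has_real_derivative v x) (at x within {0..L}) \<and>
            v x = v 0 + (LINT t:{0..x}|lborel. g t))"

text \<open>
  \<open>u\<close> lies in the domain of the Dirichlet realization of \<open>H = - d\<^sup>2/dx\<^sup>2 + W\<close> on the interval
  from 0 to \<open>L\<close>, and \<open>H u = f\<close> almost everywhere there. Only the values of \<open>u\<close> on the closed
  interval matter. (For bounded \<open>W\<close> this domain consists of the Sobolev functions of order 2
  vanishing at both end points.)
\<close>

definition dirichlet_schroedinger ::
    "(real \<Rightarrow> real) \<Rightarrow> real \<Rightarrow> (real \<Rightarrow> real) \<Rightarrow> (real \<Rightarrow> real) \<Rightarrow> bool" where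
  "dirichlet_schroedinger W L u f \<longleftrightarrow>
     u 0 = 0 \<and> u L = 0 \<and>
     (\<exists>g. sobolev2_second_deriv L u g \<and>
          (AE x in lborel. x \<in> {0<..<L} \<longrightarrow> - g x + W x * u x = f x))"

definition dirichlet_eigenvalue :: "(real \<Rightarrow> real) \<Rightarrow> real \<Rightarrow> real \<Rightarrow> bool" where
  "dirichlet_eigenvalue W L \<mu> \<longleftrightarrow>
     (\<exists>\<phi>. (\<exists>x\<in>{0<..<L}. \<phi> x \<noteq> 0) \<and> dirichlet_schroedinger W L \<phi> (\<lambda>x. \<mu> * \<phi> x))"

definition ground_state_eigenvalue :: "(real \<Rightarrow> real) \<Rightarrow> real \<Rightarrow> real" where
  "ground_state_eigenvalue W L = (LEAST \<mu>. dirichlet_eigenvalue W L \<mu>)"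

text \<open>
  The solution is unique as a function on the closed interval; it is extended by zero so that
  it is unique as a function on the whole line.
\<close>

definition landscape :: "(real \<Rightarrow> real) \<Rightarrow> real \<Rightarrow> real \<Rightarrow> real" where
  "landscape W L =
     (THE u. dirichlet_schroedinger W L u (\<lambda>x. 1) \<and> (\<forall>x. x \<notin> {0..L} \<longrightarrow> u x = 0))"

definition min_inverse_landscape :: "(real \<Rightarrow> real) \<Rightarrow> real \<Rightarrow> real" where
  "min_inverse_landscape W L = (INF x\<in>{0<..<L}. 1 / landscape W L x)"

definition eigenvalue_landscape_ratio :: "real \<Rightarrow> (int \<Rightarrow> real) \<Rightarrow> nat \<Rightarrow> real" where
  "eigenvalue_landscape_ratio k w L =
     (let W = (\<lambda>x. k * random_potential w x)
      in ground_state_eigenvalue W (real L) / min_inverse_landscape W (real L))"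

end

theory Submission
  imports Defs "HOL-Real_Asymp.Real_Asymp"
begin

text \<open>
  The idea is homogenization. Write \<open>W = k V\<close> for the potential, \<open>m\<close> for the mean of \<open>\<omega>\<close> and
  \<open>a = k m\<close>. If \<open>W\<close> is replaced by the constant \<open>a\<close>, both quantities are explicit: the ground state
  eigenvalue is \<open>A = \<pi>\<^sup>2 / L\<^sup>2 + a\<close>, the landscape function has its maximum at the midpoint, and
  the ratio depends on \<open>t = a L\<^sup>2\<close> alone. It equals
  \<open>R(t) = (\<pi>\<^sup>2 + t) (1 - 1 / cosh (sqrt t / 2)) / t\<close>, which is continuous on \<open>t \<ge> 0\<close> with
  \<open>R(0) = \<pi>\<^sup>2 / 8\<close> and tends to \<open>1\<close> as \<open>t\<close> grows. Keeping \<open>k L\<^sup>2\<close> fixed at the right value, letting it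
  tend to \<open>0\<close>, or letting it tend to infinity then gives the three claims, provided that the
  passage from \<open>W\<close> to \<open>a\<close> changes the ratio by \<open>o(1)\<close>.

  The proof of this uses one number about \<open>W\<close>: the size of the primitive
  \<open>Q(x) = \<integral>\<^sub>0\<^sup>x (W - a)\<close>. Assume \<open>\<bar>Q\<bar> \<le> \<eta> / L\<close> on \<open>[0,L]\<close>. For \<open>\<phi>\<close> vanishing at the end points,
  integration by parts gives \<open>\<integral> (W - a) \<phi>\<^sup>2 = - 2 \<integral> Q \<phi> \<phi>'\<close>, and by Poincare's inequality this is at
  most \<open>2 \<eta> \<integral> \<phi>'\<^sup>2\<close>. So the quadratic forms of the two operators differ by a relative error of order
  \<open>\<eta>\<close>, and so do their lowest eigenvalues (\<open>ground_state_eigenvalue_upper\<close> and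
  \<open>ground_state_eigenvalue_lower\<close>). The same integration by parts in the energy identity for the
  difference of the two landscape functions bounds that difference by \<open>25 \<eta> / A\<close>
  (\<open>landscape_comparison\<close>). Together the ratio differs from \<open>R(a L\<^sup>2)\<close> by at most \<open>60 \<eta>\<close>,
  uniformly in \<open>a\<close> and \<open>L\<close> (\<open>ratio_estimate\<close>).

  For the random potential, \<open>Q\<close> interpolates \<open>k\<close> times the centred partial sums of the \<open>\<omega>\<^sub>j\<close>.
  Hoeffding's inequality and the Borel-Cantelli lemma bound these sums almost surely by
  \<open>K + n\<^bsup>3/4\<^esup>\<close> (\<open>partial_sums_deviation\<close>), so \<open>\<eta>\<close> is of order \<open>k L\<^bsup>7/4\<^esup>\<close>. This tends to \<open>0\<close> if
  \<open>k L\<^sup>2\<close> is bounded, and also if \<open>k L\<^bsup>2-\<beta>\<^esup>\<close> is bounded for some \<open>\<beta> < 1/4\<close>.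

  Existence of the ground state, its positivity, and existence and uniqueness of the landscape
  function come from the shooting method: the solution \<open>y\<^sub>\<mu>\<close> of \<open>y'' = (W - \<mu>) y\<close> with
  \<open>y(0) = 0\<close> and \<open>y'(0) = 1\<close> is positive on \<open>(0,L]\<close> precisely for \<open>\<mu>\<close> below the smallest
  eigenvalue (\<open>ground_state\<close>).
\<close>

section \<open>A linear Volterra equation\<close>

text \<open>
  Picard iteration: the increments of successive iterates are bounded by the terms of an
  exponential series, so they are summable uniformly on the whole interval. The hypothesis \<open>integ\<close> lets \<open>b\<close> have jumps.
\<close>
lemma volterra_solution:
  fixes b h :: "real \<Rightarrow> real"
  assumes L: "0 \<le> L"
    and bound: "\<And>x. x \<in> {0..L} \<Longrightarrow> \<bar>b x\<bar> \<le> K"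
    and integ: "\<And>f. continuous_on {0..L} f \<Longrightarrow> (\<lambda>x. b x * f x) integrable_on {0..L}"
    and h: "continuous_on {0..L} h"
  shows "\<exists>u. continuous_on {0..L} u \<and>
           (\<forall>x\<in>{0..L}. u x = h x + integral {0..x} (\<lambda>s. integral {0..s} (\<lambda>r. b r * u r)))"
proof -
  define J where "J f s = integral {0..s} (\<lambda>r. b r * f r)" for f s
  define T where "T f x = integral {0..x} (J f)" for f x
  have K: "0 \<le> K" using bound[of 0] L by auto
  have integ': "(\<lambda>x. b x * f x) integrable_on {0..s}" if "continuous_on {0..L} f" "s \<in> {0..L}" for f s
    by (rule integrable_on_subinterval[OF integ[OF that(1)]]) (use that in auto)
  have J_cont: "continuous_on {0..L} (J f)" if "continuous_on {0..L} f" for f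
    unfolding J_def by (rule indefinite_integral_continuous_1[OF integ[OF that]])
  have J_int: "J f integrable_on {0..x}" if "continuous_on {0..L} f" "x \<in> {0..L}" for f x
    by (rule integrable_continuous_real, rule continuous_on_subset[OF J_cont]) (use that in auto)
  have T_cont: "continuous_on {0..L} (T f)" if "continuous_on {0..L} f" for f
    unfolding T_def
    by (intro indefinite_integral_continuous_1 integrable_continuous_real J_cont that)
  have J_diff: "J (\<lambda>x. f x - g x) s = J f s - J g s"
    if "continuous_on {0..L} f" "continuous_on {0..L} g" "s \<in> {0..L}" for f g s
    unfolding J_def right_diff_distrib
    by (rule integral_diff; rule integ') (use that in auto)
  have T_diff: "T (\<lambda>x. f x - g x) x = T f x - T g x"
    if "continuous_on {0..L} f" "continuous_on {0..L} g" "x \<in> {0..L}" for f g x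
  proof -
    have "T (\<lambda>x. f x - g x) x = integral {0..x} (\<lambda>s. J f s - J g s)"
      unfolding T_def by (rule integral_cong, rule J_diff) (use that in auto)
    also have "\<dots> = T f x - T g x"
      unfolding T_def by (rule integral_diff; rule J_int) (use that in auto)
    finally show ?thesis .
  qed
  have power_int: "((\<lambda>r. c * r ^ n / fact n) has_integral c * s ^ Suc n / fact (Suc n)) {0..s}"
    if "0 \<le> s" for c s :: real and n
  proof -
    have "((\<lambda>r. c * r ^ n / fact n) has_integral
        c * s ^ Suc n / fact (Suc n) - c * 0 ^ Suc n / fact (Suc n)) {0..s}"
      by (rule fundamental_theorem_of_calculus[OF that])
         (auto intro!: derivative_eq_intros
           simp: has_real_derivative_iff_has_vector_derivative[symmetric] field_simps
             simp del: fact_Suc power_Suc, simp add: field_simps)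
    then show ?thesis by simp
  qed
  have T_bound: "\<bar>T f x\<bar> \<le> L * K * C * x ^ Suc n / fact (Suc n)"
    if f: "continuous_on {0..L} f" and x: "x \<in> {0..L}" and C: "0 \<le> C"
      and le: "\<And>x. x \<in> {0..L} \<Longrightarrow> \<bar>f x\<bar> \<le> C * x ^ n / fact n" for f x C n
  proof -
    have J_le: "\<bar>J f s\<bar> \<le> K * C * x ^ Suc n / fact (Suc n)" if s: "s \<in> {0..x}" for s
    proof -
      have sL: "s \<in> {0..L}" using s x by auto
      have "norm (J f s) \<le> integral {0..s} (\<lambda>r. (K * C) * r ^ n / fact n)"
        unfolding J_def
      proof (rule integral_norm_bound_integral)
        show "(\<lambda>r. b r * f r) integrable_on {0..s}" by (rule integ'[OF f sL])
        show "(\<lambda>r. (K * C) * r ^ n / fact n) integrable_on {0..s}"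
          using power_int[of s "K * C" n] s by auto
        fix r assume "r \<in> {0..s}"
        then have r: "r \<in> {0..L}" using sL by auto
        have "\<bar>b r\<bar> * \<bar>f r\<bar> \<le> K * (C * r ^ n / fact n)"
          by (intro mult_mono bound le r K) auto
        then show "norm (b r * f r) \<le> (K * C) * r ^ n / fact n"
          by (simp add: abs_mult)
      qed
      also have "\<dots> = K * C * s ^ Suc n / fact (Suc n)"
        using power_int[of s "K * C" n] s by (auto dest: integral_unique)
      also have "\<dots> \<le> K * C * x ^ Suc n / fact (Suc n)"
        by (intro divide_right_mono mult_left_mono power_mono) (use s K C in auto)
      finally show ?thesis by simp
    qed
    have "norm (T f x) \<le> (K * C * x ^ Suc n / fact (Suc n)) * (x - 0)"
      unfolding T_def
      by (rule integral_bound) (use x J_le in \<open>auto intro!: continuous_on_subset[OF J_cont[OF f]]\<close>)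
    also have "\<dots> \<le> (K * C * x ^ Suc n / fact (Suc n)) * L"
      by (intro mult_left_mono) (use x K C in auto)
    finally show ?thesis by (simp add: mult_ac)
  qed
  define U where "U = rec_nat h (\<lambda>_ f x. h x + T f x)"
  have U0: "U 0 = h" and US: "U (Suc n) = (\<lambda>x. h x + T (U n) x)" for n
    by (simp_all add: U_def)
  have U_cont: "continuous_on {0..L} (U n)" for n
    by (induction n) (auto simp: U0 US intro!: continuous_intros h T_cont)
  obtain C where C: "0 \<le> C" "\<And>x. x \<in> {0..L} \<Longrightarrow> \<bar>T h x\<bar> \<le> C"
  proof -
    have "bounded (T h ` {0..L})"
      by (intro compact_imp_bounded compact_continuous_image T_cont h compact_Icc)
    then obtain C where "C > 0" "\<And>y. y \<in> T h ` {0..L} \<Longrightarrow> norm y \<le> C"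
      by (auto simp: bounded_pos)
    then show ?thesis using that[of C] by auto
  qed
  define D where "D n x = U (Suc n) x - U n x" for n x
  have D_cont: "continuous_on {0..L} (D n)" for n
    unfolding D_def by (intro continuous_intros U_cont)
  have D_Suc: "D (Suc n) x = T (D n) x" if "x \<in> {0..L}" for n x
    unfolding D_def US[of "Suc n"] US[of n]
    using T_diff[OF U_cont[of "Suc n"] U_cont[of n] that] by (simp add: US)
  have D_bound: "\<bar>D n x\<bar> \<le> (L * K) ^ n * C * x ^ n / fact n" if "x \<in> {0..L}" for n x
    using that
  proof (induction n arbitrary: x)
    case 0
    then show ?case using C by (simp add: D_def US U0)
  next
    case (Suc n)
    have "\<bar>T (D n) x\<bar> \<le> L * K * ((L * K) ^ n * C) * x ^ Suc n / fact (Suc n)"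
      by (rule T_bound[OF D_cont Suc.prems]) (use Suc.IH C K L in auto)
    then show ?case using D_Suc[OF Suc.prems] by (simp add: mult_ac)
  qed
  have D_bound': "norm (D n x) \<le> C * (inverse (fact n) * (L * K * L) ^ n)" if "x \<in> {0..L}" for n x
  proof -
    have "\<bar>D n x\<bar> \<le> (L * K) ^ n * C * L ^ n / fact n"
      by (rule order_trans[OF D_bound[OF that]], intro divide_right_mono mult_left_mono power_mono)
         (use that L K C in auto)
    then show ?thesis by (simp add: power_mult_distrib field_simps)
  qed
  define d where "d x = (\<Sum>n. D n x)" for x
  have unif: "uniform_limit {0..L} (\<lambda>N x. \<Sum>n<N. D n x) d sequentially"
    unfolding d_def
    by (rule Weierstrass_m_test[OF D_bound']) (auto intro!: summable_mult summable_exp)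
  have U_sum: "(\<Sum>n<N. D n x) = U N x - h x" for N x
    unfolding D_def by (subst sum_lessThan_telescope) (simp add: U0)
  define u where "u x = h x + d x" for x
  have unif_u: "uniform_limit {0..L} U u sequentially"
  proof -
    have "uniform_limit {0..L} (\<lambda>N x. h x) h sequentially"
      by (rule uniform_limit_const)
    from uniform_limit_add[OF this unif] show ?thesis
      by (simp add: U_sum u_def[abs_def])
  qed
  have u_cont: "continuous_on {0..L} u"
    by (rule uniform_limit_theorem[OF _ unif_u]) (auto intro!: always_eventually U_cont)
  have "u x = h x + T u x" if x: "x \<in> {0..L}" for x
  proof -
    have "(\<lambda>n. T (U n) x) \<longlonglongrightarrow> T u x"
    proof (rule LIMSEQ_I)
      fix e :: real assume e: "0 < e"
      define e' where "e' = e / (1 + L * K * L)"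
      have e': "e' > 0" using e L K by (auto simp: e'_def intro!: divide_pos_pos add_pos_nonneg)
      from uniform_limitD[OF unif_u e'] obtain N where
        N: "\<And>n x. n \<ge> N \<Longrightarrow> x \<in> {0..L} \<Longrightarrow> dist (U n x) (u x) < e'"
        unfolding eventually_sequentially by blast
      show "\<exists>N. \<forall>n\<ge>N. norm (T (U n) x - T u x) < e"
      proof (intro exI allI impI)
        fix n assume n: "N \<le> n"
        have "\<bar>T (\<lambda>x. U n x - u x) x\<bar> \<le> L * K * e' * x ^ Suc 0 / fact (Suc 0)"
          using T_bound[of "\<lambda>x. U n x - u x" x e' 0] x e' N[OF n]
          by (auto intro!: continuous_intros U_cont u_cont simp: dist_real_def less_imp_le)
        also have "\<dots> \<le> L * K * e' * L" using x L K e' by (auto intro!: mult_left_mono)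
        also have "\<dots> < (1 + L * K * L) * e'" using e' by (simp add: algebra_simps)
        also have "\<dots> = e" unfolding e'_def using L K
          by (simp add: add_pos_nonneg order_less_imp_not_eq2)
        finally show "norm (T (U n) x - T u x) < e"
          using T_diff[OF U_cont[of n] u_cont x] by simp
      qed
    qed
    then have "(\<lambda>n. U (Suc n) x) \<longlonglongrightarrow> h x + T u x"
      unfolding US by (intro tendsto_intros)
    moreover have "(\<lambda>n. U (Suc n) x) \<longlonglongrightarrow> u x"
      using tendsto_uniform_limitI[OF unif_u x] by (rule LIMSEQ_Suc)
    ultimately show ?thesis using LIMSEQ_unique by blast
  qed
  then show ?thesis using u_cont unfolding T_def J_def by blast
qed

section \<open>Solutions of second order equations with jumps\<close>

text \<open>
  The potential jumps at the integers, so the second derivative of a solution exists only off a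
  finite set. The pair consists of a continuously differentiable \<open>u\<close> and its derivative \<open>v\<close>, and
  \<open>h\<close> is the derivative of \<open>v\<close> off \<open>S\<close>. The fundamental theorem of calculus with finitely many
  exceptions applies to all polynomial expressions in such functions.
\<close>
definition C1_pair :: "real set \<Rightarrow> real \<Rightarrow> real \<Rightarrow> (real \<Rightarrow> real) \<Rightarrow> (real \<Rightarrow> real) \<Rightarrow> (real \<Rightarrow> real) \<Rightarrow> bool"
  where "C1_pair S a b u v h \<longleftrightarrow>
    continuous_on {a..b} u \<and> continuous_on {a..b} v \<and>
    (\<forall>x\<in>{a<..<b}. (u has_real_derivative v x) (at x)) \<and>
    (\<forall>x\<in>{a<..<b} - S. (v has_real_derivative h x) (at x))"

lemma C1_pairD:
  assumes "C1_pair S a b u v h"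
  shows "continuous_on {a..b} u" "continuous_on {a..b} v"
    "\<And>x. x \<in> {a<..<b} \<Longrightarrow> (u has_real_derivative v x) (at x)"
    "\<And>x. x \<in> {a<..<b} - S \<Longrightarrow> (v has_real_derivative h x) (at x)"
  using assms by (auto simp: C1_pair_def)

lemma C1_pair_subinterval:
  assumes "C1_pair S a b u v h" "a \<le> c" "d \<le> b"
  shows "C1_pair S c d u v h"
proof -
  have "{c..d} \<subseteq> {a..b}" using assms by auto
  then show ?thesis
    using assms unfolding C1_pair_def by (auto intro: continuous_on_subset)
qed

lemma C1_pair_linear:
  assumes "C1_pair S a b u1 v1 h1" "C1_pair S a b u2 v2 h2"
    and "\<And>x. x \<in> {a<..<b} - S \<Longrightarrow> h x = c * h1 x + e * h2 x"
  shows "C1_pair S a b (\<lambda>x. c * u1 x + e * u2 x) (\<lambda>x. c * v1 x + e * v2 x) h"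
  unfolding C1_pair_def
  by (intro conjI ballI continuous_intros C1_pairD[OF assms(1)] C1_pairD[OF assms(2)]
      DERIV_add DERIV_cmult)
     (auto simp: assms(3) intro!: DERIV_add DERIV_cmult C1_pairD[OF assms(1)] C1_pairD[OF assms(2)])

lemma C1_pair_cong:
  assumes "C1_pair S a b u v h" "\<And>x. x \<in> {a<..<b} - S \<Longrightarrow> h x = h' x"
  shows "C1_pair S a b u v h'"
  using assms unfolding C1_pair_def by auto

lemma has_integral_derivative:
  fixes F F' :: "real \<Rightarrow> real"
  assumes "finite S" "a \<le> b" "continuous_on {a..b} F"
    and "\<And>x. x \<in> {a<..<b} - S \<Longrightarrow> (F has_real_derivative F' x) (at x)"
  shows "(F' has_integral (F b - F a)) {a..b}"
  using assms by (intro fundamental_theorem_of_calculus_interior_strong[where S = S])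
    (auto simp: has_real_derivative_iff_has_vector_derivative)

lemma increment_le:
  fixes F F' :: "real \<Rightarrow> real"
  assumes "finite S" "a \<le> b" "continuous_on {a..b} F"
    and "\<And>x. x \<in> {a<..<b} - S \<Longrightarrow> (F has_real_derivative F' x) (at x)"
    and "\<And>x. x \<in> {a<..<b} - S \<Longrightarrow> F' x \<le> c"
  shows "F b - F a \<le> c * (b - a)"
proof -
  let ?G = "\<lambda>x. if x \<in> {a<..<b} - S then F' x else c"
  have "(?G has_integral (F b - F a)) {a..b}"
    by (rule has_integral_derivative[OF assms(1-3)]) (use assms(4) in auto)
  moreover have "((\<lambda>x. c) has_integral c * (b - a)) {a..b}"
    using has_integral_const_real[of c a b] assms(2) by (simp add: mult.commute)
  ultimately show ?thesis
    by (rule has_integral_le) (use assms(5) in auto)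
qed

text \<open>
  Gronwall's inequality for \<open>z\<^sup>2 + w\<^sup>2\<close>. It serves twice: with \<open>F = 0\<close> as uniqueness of the initial
  value problem, and with a forcing term proportional to \<open>\<mu> - \<nu>\<close> as continuity of solutions in the
  spectral parameter.
\<close>
lemma ode_energy_bound:
  assumes fin: "finite S" and L: "0 \<le> L"
    and z: "C1_pair S 0 L z w (\<lambda>x. c x * z x + f x)"
    and init: "z 0 = 0" "w 0 = 0"
    and c: "\<And>x. x \<in> {0<..<L} \<Longrightarrow> \<bar>c x\<bar> \<le> K"
    and f: "\<And>x. x \<in> {0<..<L} \<Longrightarrow> \<bar>f x\<bar> \<le> F"
    and x: "x \<in> {0..L}"
  shows "(z x)\<^sup>2 + (w x)\<^sup>2 \<le> F\<^sup>2 * L * exp ((\<bar>K\<bar> + 2) * L)"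
proof -
  define C where "C = \<bar>K\<bar> + 2"
  define E where "E y = ((z y)\<^sup>2 + (w y)\<^sup>2) * exp (- C * y)" for y
  define E' where "E' y = (2 * z y * w y + 2 * w y * (c y * z y + f y)) * exp (- C * y)
      - C * ((z y)\<^sup>2 + (w y)\<^sup>2) * exp (- C * y)" for y
  have zx: "C1_pair S 0 x z w (\<lambda>x. c x * z x + f x)"
    by (rule C1_pair_subinterval[OF z]) (use x in auto)
  note zd = C1_pairD[OF zx]
  have "E x - E 0 \<le> F\<^sup>2 * (x - 0)"
  proof (rule increment_le[OF fin])
    show "0 \<le> x" using x by simp
    show "continuous_on {0..x} E" unfolding E_def by (intro continuous_intros zd)
    fix y assume y: "y \<in> {0<..<x} - S"
    show "(E has_real_derivative E' y) (at y)"
      unfolding E_def E'_def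
      using zd(3)[of y] zd(4)[OF y] y
      by (auto intro!: derivative_eq_intros simp: algebra_simps power2_eq_square)
    have yL: "y \<in> {0<..<L}" using y x by auto
    have "2 * (z y * w y) \<le> (z y)\<^sup>2 + (w y)\<^sup>2"
      using sum_squares_bound[of "z y" "w y"] by simp
    moreover have "2 * w y * (c y * z y) \<le> \<bar>K\<bar> * ((z y)\<^sup>2 + (w y)\<^sup>2)"
    proof -
      have "2 * w y * (c y * z y) \<le> \<bar>c y\<bar> * (2 * \<bar>z y\<bar> * \<bar>w y\<bar>)"
        by (rule order_trans[OF abs_ge_self]) (simp add: abs_mult)
      also have "\<dots> \<le> \<bar>K\<bar> * ((z y)\<^sup>2 + (w y)\<^sup>2)"
        using sum_squares_bound[of "\<bar>z y\<bar>" "\<bar>w y\<bar>"] c[OF yL]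
        by (intro mult_mono) auto
      finally show ?thesis .
    qed
    moreover have "2 * (w y * f y) \<le> (w y)\<^sup>2 + (f y)\<^sup>2"
      using sum_squares_bound[of "w y" "f y"] by simp
    moreover have "(f y)\<^sup>2 \<le> F\<^sup>2" using power_mono[OF f[OF yL], of 2] by simp
    moreover have "0 \<le> (z y)\<^sup>2" by simp
    ultimately have "2 * z y * w y + 2 * w y * (c y * z y + f y) - C * ((z y)\<^sup>2 + (w y)\<^sup>2) \<le> F\<^sup>2"
      unfolding C_def by (simp add: algebra_simps) (insert zero_le_power2[of "z y"], linarith)
    then have "(2 * z y * w y + 2 * w y * (c y * z y + f y) - C * ((z y)\<^sup>2 + (w y)\<^sup>2)) * exp (- C * y)
        \<le> F\<^sup>2 * exp (- C * y)"
      by (rule mult_right_mono) simp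
    also have "\<dots> \<le> F\<^sup>2 * 1"
    proof (rule mult_left_mono)
      have "0 \<le> C * y" using y by (simp add: C_def)
      then show "exp (- C * y) \<le> 1" by simp
    qed simp
    finally show "E' y \<le> F\<^sup>2" unfolding E'_def by (simp add: algebra_simps)
  qed
  then have "E x \<le> F\<^sup>2 * x" by (simp add: E_def init)
  then have "E x * exp (C * x) \<le> (F\<^sup>2 * x) * exp (C * x)" by (rule mult_right_mono) simp
  also have "\<dots> \<le> (F\<^sup>2 * L) * exp (C * L)"
    by (intro mult_mono) (use x C_def in \<open>auto intro!: mult_left_mono\<close>)
  also have "E x * exp (C * x) = (z x)\<^sup>2 + (w x)\<^sup>2"
    by (simp add: E_def mult.assoc flip: exp_add)
  finally show ?thesis by (simp add: C_def mult.assoc)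
qed

section \<open>Initial value problems and the shooting function\<close>

locale potential =
  fixes W :: "real \<Rightarrow> real" and L B :: real and S :: "real set"
  assumes L_pos: "0 < L" and fin: "finite S"
    and W_meas [measurable]: "W \<in> borel_measurable borel"
    and W_nonneg: "0 \<le> W x" and W_le: "W x \<le> B"
    and W_cont: "x \<in> {0<..<L} - S \<Longrightarrow> isCont W x"
begin

lemma B_nonneg: "0 \<le> B" using W_nonneg[of 0] W_le[of 0] by linarith

lemma set_integrable_W:
  assumes "continuous_on {0..L} f"
  shows "set_integrable lborel {0..L} (\<lambda>x. (W x - \<mu>) * f x)"
proof (rule set_integrable_bound)
  show "set_integrable lborel {0..L} (\<lambda>x. (B + \<bar>\<mu>\<bar>) * f x)"
    by (intro borel_integrable_atLeastAtMost' continuous_intros assms)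
  have "set_borel_measurable lborel {0..L} f"
    using borel_integrable_atLeastAtMost'[OF assms] unfolding set_integrable_def set_borel_measurable_def
    by (rule borel_measurable_integrable)
  then have [measurable]: "(\<lambda>x. indicator {0..L} x *\<^sub>R f x) \<in> borel_measurable lborel"
    by (simp add: set_borel_measurable_def)
  have "(\<lambda>x. (W x - \<mu>) * (indicator {0..L} x *\<^sub>R f x)) \<in> borel_measurable lborel"
    by measurable
  then show "set_borel_measurable lborel {0..L} (\<lambda>x. (W x - \<mu>) * f x)"
    by (simp add: set_borel_measurable_def mult_ac)
  have "\<bar>W x - \<mu>\<bar> * \<bar>f x\<bar> \<le> \<bar>B + \<bar>\<mu>\<bar>\<bar> * \<bar>f x\<bar>" for x
    by (rule mult_right_mono) (use W_nonneg[of x] W_le[of x] in auto)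
  then show "AE x in lborel. x \<in> {0..L} \<longrightarrow> norm ((W x - \<mu>) * f x) \<le> norm ((B + \<bar>\<mu>\<bar>) * f x)"
    by (auto simp: abs_mult)
qed

lemma integrable_W:
  assumes "continuous_on {0..L} f"
  shows "(\<lambda>x. (W x - \<mu>) * f x) integrable_on {0..L}"
  by (rule set_borel_integral_eq_integral(1)[OF set_integrable_W[OF assms]])

text \<open>
  At points off \<open>S\<close> the integrand is continuous, so its indefinite integral is differentiable there.
  The summand \<open>g\<close> allows for the inhomogeneous equation of the landscape function.
\<close>
lemma primitive_W:
  fixes \<mu> :: real
  assumes f: "continuous_on {0..L} f" and g: "continuous_on {0<..<L} g"
    "g integrable_on {0..L}"
  defines "V \<equiv> \<lambda>x. integral {0..x} (\<lambda>r. (W r - \<mu>) * f r + g r)"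
  shows "continuous_on {0..L} V"
    and "x \<in> {0<..<L} - S \<Longrightarrow> (V has_real_derivative (W x - \<mu>) * f x + g x) (at x)"
proof -
  have int: "(\<lambda>r. (W r - \<mu>) * f r + g r) integrable_on {0..L}"
    by (intro integrable_add integrable_W f g)
  then show "continuous_on {0..L} V"
    unfolding V_def by (rule indefinite_integral_continuous_1)
  assume x: "x \<in> {0<..<L} - S"
  have op: "open ({0<..<L} - S)" by (intro open_Diff finite_imp_closed fin open_greaterThanLessThan)
  have "continuous (at x) f" "continuous (at x) g"
    using x f g(1) by (auto intro: continuous_on_interior simp: continuous_on_eq_continuous_at)
  then have "continuous (at x) (\<lambda>r. (W r - \<mu>) * f r + g r)"
    using W_cont[OF x] by (intro continuous_intros)
  then have "continuous (at x within ({0..L} - S)) (\<lambda>r. (W r - \<mu>) * f r + g r)"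
    by (rule continuous_at_imp_continuous_at_within)
  then have "(V has_vector_derivative ((W x - \<mu>) * f x + g x)) (at x within ({0..L} - S))"
    unfolding V_def
    by (intro integral_has_vector_derivative_continuous_at int fin) (use x in auto)
  then have "(V has_vector_derivative ((W x - \<mu>) * f x + g x)) (at x within ({0<..<L} - S))"
    by (rule has_vector_derivative_within_subset) auto
  then show "(V has_real_derivative (W x - \<mu>) * f x + g x) (at x)"
    using at_within_open[OF x op] by (simp add: has_real_derivative_iff_has_vector_derivative)
qed

lemma ivp_solution:
  obtains u v where "C1_pair S 0 L u v (\<lambda>x. (W x - \<mu>) * u x + f)" "u 0 = c0" "v 0 = c1"
proof -
  define h where "h x = c0 + c1 * x + f * x\<^sup>2 / 2" for x
  have h: "continuous_on {0..L} h" unfolding h_def by (intro continuous_intros) auto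
  have "\<bar>W x - \<mu>\<bar> \<le> B + \<bar>\<mu>\<bar>" for x using W_nonneg[of x] W_le[of x] by auto
  then obtain u where u: "continuous_on {0..L} u"
    and eq: "\<And>x. x \<in> {0..L} \<Longrightarrow>
      u x = h x + integral {0..x} (\<lambda>s. integral {0..s} (\<lambda>r. (W r - \<mu>) * u r))"
    using volterra_solution[of L "\<lambda>x. W x - \<mu>" "B + \<bar>\<mu>\<bar>" h] integrable_W h L_pos by force
  define V where "V s = integral {0..s} (\<lambda>r. (W r - \<mu>) * u r)" for s
  define v where "v x = c1 + f * x + V x" for x
  have Vc: "continuous_on {0..L} V"
    and Vd: "\<And>x. x \<in> {0<..<L} - S \<Longrightarrow> (V has_real_derivative (W x - \<mu>) * u x) (at x)"
    using primitive_W(1)[OF u, of "\<lambda>_. 0" \<mu>] primitive_W(2)[OF u, of "\<lambda>_. 0" _ \<mu>]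
    unfolding V_def[abs_def] by auto
  have "(u has_real_derivative v x) (at x)" if x: "x \<in> {0<..<L}" for x
  proof -
    have "((\<lambda>x. integral {0..x} V) has_real_derivative V x) (at x within {0..L})"
      by (rule integral_has_real_derivative[OF Vc]) (use x in auto)
    then have "((\<lambda>x. integral {0..x} V) has_real_derivative V x) (at x)"
      using x by (simp add: at_within_Icc_at)
    then have "((\<lambda>x. h x + integral {0..x} V) has_real_derivative v x) (at x)"
      unfolding h_def v_def by (auto intro!: derivative_eq_intros)
    then show ?thesis
      by (rule has_field_derivative_transform_within_open[where S = "{0<..<L}"])
         (use x eq in \<open>auto simp: V_def[abs_def]\<close>)
  qed
  moreover have "(v has_real_derivative (W x - \<mu>) * u x + f) (at x)" if "x \<in> {0<..<L} - S" for x
    unfolding v_def using Vd[OF that] by (auto intro!: derivative_eq_intros)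
  moreover have "continuous_on {0..L} v" unfolding v_def by (intro continuous_intros Vc)
  ultimately have "C1_pair S 0 L u v (\<lambda>x. (W x - \<mu>) * u x + f)"
    using u by (auto simp: C1_pair_def)
  moreover have "u 0 = c0" using eq[of 0] L_pos by (simp add: h_def)
  moreover have "v 0 = c1" by (simp add: v_def V_def)
  ultimately show ?thesis using that by blast
qed

lemma ivp_unique:
  assumes "C1_pair S 0 L u v (\<lambda>x. (W x - \<mu>) * u x)" "u 0 = 0" "v 0 = 0" "x \<in> {0..L}"
  shows "u x = 0" "v x = 0"
proof -
  have "(u x)\<^sup>2 + (v x)\<^sup>2 \<le> 0\<^sup>2 * L * exp ((\<bar>B + \<bar>\<mu>\<bar>\<bar> + 2) * L)"
  proof (rule ode_energy_bound[where f = "\<lambda>_. 0" and c = "\<lambda>x. W x - \<mu>" and z = u and w = v, OF fin _ _ assms(2,3) _ _ assms(4)])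
    show "C1_pair S 0 L u v (\<lambda>x. (W x - \<mu>) * u x + 0)" using assms(1) by simp
    show "\<bar>W x - \<mu>\<bar> \<le> B + \<bar>\<mu>\<bar>" for x using W_nonneg[of x] W_le[of x] by auto
  qed (use L_pos in auto)
  then show "u x = 0" "v x = 0" by (simp_all add: sum_power2_le_zero_iff)
qed

text \<open>
  The solution of \<open>y'' = (W - \<mu>) y\<close> with \<open>y(0) = 0\<close> and \<open>y'(0) = 1\<close>, together with its derivative.
\<close>
definition shoot :: "real \<Rightarrow> (real \<Rightarrow> real) \<times> (real \<Rightarrow> real)" where
  "shoot \<mu> = (SOME p. C1_pair S 0 L (fst p) (snd p) (\<lambda>x. (W x - \<mu>) * fst p x)
      \<and> fst p 0 = 0 \<and> snd p 0 = 1)"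

definition "sol \<mu> = fst (shoot \<mu>)"
definition "sol' \<mu> = snd (shoot \<mu>)"

lemma shoot:
  shows shoot_pair: "C1_pair S 0 L (sol \<mu>) (sol' \<mu>) (\<lambda>x. (W x - \<mu>) * sol \<mu> x)"
    and sol_0: "sol \<mu> 0 = 0" and sol'_0: "sol' \<mu> 0 = 1"
proof -
  obtain u v where "C1_pair S 0 L u v (\<lambda>x. (W x - \<mu>) * u x + 0)" "u 0 = 0" "v 0 = 1"
    by (rule ivp_solution)
  then have "\<exists>p. C1_pair S 0 L (fst p) (snd p) (\<lambda>x. (W x - \<mu>) * fst p x)
      \<and> fst p 0 = 0 \<and> snd p 0 = 1"
    by (intro exI[of _ "(u, v)"]) simp
  from someI_ex[OF this] show "C1_pair S 0 L (sol \<mu>) (sol' \<mu>) (\<lambda>x. (W x - \<mu>) * sol \<mu> x)"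
    "sol \<mu> 0 = 0" "sol' \<mu> 0 = 1"
    unfolding sol_def sol'_def shoot_def by auto
qed

text \<open>
  Solutions vanishing at \<open>0\<close> form a line. Hence an eigenfunction for \<open>\<mu>\<close> is a multiple of the
  shooting function, and \<open>\<mu>\<close> is an eigenvalue if and only if the shooting function vanishes at \<open>L\<close>.
\<close>
lemma ivp_eq_shoot:
  assumes "C1_pair S 0 L u v (\<lambda>x. (W x - \<mu>) * u x)" "u 0 = 0" "x \<in> {0..L}"
  shows "u x = v 0 * sol \<mu> x"
proof -
  have "C1_pair S 0 L (\<lambda>x. 1 * u x + (- v 0) * sol \<mu> x) (\<lambda>x. 1 * v x + (- v 0) * sol' \<mu> x)
      (\<lambda>x. (W x - \<mu>) * (1 * u x + (- v 0) * sol \<mu> x))"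
    by (rule C1_pair_linear[OF assms(1) shoot_pair]) (simp add: algebra_simps)
  from ivp_unique(1)[OF this _ _ assms(3)] show ?thesis
    by (simp add: assms(2) sol_0 sol'_0)
qed

lemma shoot_continuous_in_eigenvalue:
  assumes e: "0 < e"
  shows "\<exists>d>0. \<forall>\<mu>. \<bar>\<mu> - \<nu>\<bar> < d \<longrightarrow> (\<forall>x\<in>{0..L}. \<bar>sol \<mu> x - sol \<nu> x\<bar> < e \<and> \<bar>sol' \<mu> x - sol' \<nu> x\<bar> < e)"
proof -
  have "bounded (sol \<nu> ` {0..L})"
    by (intro compact_imp_bounded compact_continuous_image C1_pairD(1)[OF shoot_pair] compact_Icc)
  then obtain M where M: "M > 0" "\<And>x. x \<in> {0..L} \<Longrightarrow> \<bar>sol \<nu> x\<bar> \<le> M"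
    by (auto simp: bounded_pos)
  define K where "K = B + \<bar>\<nu>\<bar> + 1"
  define C where "C = M\<^sup>2 * L * exp ((\<bar>K\<bar> + 2) * L)"
  have C: "C > 0" using M L_pos by (auto simp: C_def)
  define d where "d = min 1 (e / sqrt C)"
  have d: "d > 0" using e C by (auto simp: d_def)
  show ?thesis
  proof (intro exI[of _ d] conjI d allI impI ballI)
    fix \<mu> x assume \<mu>: "\<bar>\<mu> - \<nu>\<bar> < d" and x: "x \<in> {0..L}"
    have pair: "C1_pair S 0 L (\<lambda>x. 1 * sol \<mu> x + (-1) * sol \<nu> x) (\<lambda>x. 1 * sol' \<mu> x + (-1) * sol' \<nu> x)
       (\<lambda>x. (W x - \<mu>) * (1 * sol \<mu> x + (-1) * sol \<nu> x) + (\<nu> - \<mu>) * sol \<nu> x)"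
      by (rule C1_pair_linear[OF shoot_pair shoot_pair]) (simp add: algebra_simps)
    have "(1 * sol \<mu> x + (-1) * sol \<nu> x)\<^sup>2 + (1 * sol' \<mu> x + (-1) * sol' \<nu> x)\<^sup>2
        \<le> (\<bar>\<mu> - \<nu>\<bar> * M)\<^sup>2 * L * exp ((\<bar>K\<bar> + 2) * L)"
    proof (rule ode_energy_bound[OF fin _ pair _ _ _ _ x])
      fix x assume "x \<in> {0<..<L}"
      then have x: "x \<in> {0..L}" by auto
      show "\<bar>W x - \<mu>\<bar> \<le> K"
        using W_nonneg[of x] W_le[of x] \<mu> by (auto simp: K_def d_def)
      have "\<bar>\<nu> - \<mu>\<bar> * \<bar>sol \<nu> x\<bar> \<le> \<bar>\<nu> - \<mu>\<bar> * M" by (intro mult_left_mono M x) auto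
      then show "\<bar>(\<nu> - \<mu>) * sol \<nu> x\<bar> \<le> \<bar>\<mu> - \<nu>\<bar> * M" by (simp add: abs_mult abs_minus_commute)
    qed (use L_pos in \<open>auto simp: sol_0 sol'_0\<close>)
    also have "\<dots> = C * \<bar>\<mu> - \<nu>\<bar>\<^sup>2" by (simp add: C_def power_mult_distrib mult_ac)
    also have "\<dots> < C * (e / sqrt C)\<^sup>2"
      using \<mu> C by (intro mult_strict_left_mono power_strict_mono) (auto simp: d_def)
    also have "\<dots> = e\<^sup>2" using C by (simp add: power_divide)
    finally have *: "(sol \<mu> x - sol \<nu> x)\<^sup>2 + (sol' \<mu> x - sol' \<nu> x)\<^sup>2 < e\<^sup>2" by simp
    have "(sol \<mu> x - sol \<nu> x)\<^sup>2 < e\<^sup>2" "(sol' \<mu> x - sol' \<nu> x)\<^sup>2 < e\<^sup>2"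
      using * zero_le_power2[of "sol \<mu> x - sol \<nu> x"] zero_le_power2[of "sol' \<mu> x - sol' \<nu> x"] by linarith+
    then show "\<bar>sol \<mu> x - sol \<nu> x\<bar> < e" "\<bar>sol' \<mu> x - sol' \<nu> x\<bar> < e"
      using e by (auto intro: power2_less_imp_less)
  qed
qed

end

lemma C1_pair_endpoint_derivative:
  assumes "C1_pair S a b u v h" "a < b" "x \<in> {a..b}"
  shows "(u has_real_derivative v x) (at x within {a..b})"
proof -
  note uv = C1_pairD[OF assms(1)]
  have d: "((\<lambda>x. u a + integral {a..x} v) has_real_derivative v x) (at x within {a..b})"
    using integral_has_real_derivative[OF uv(2) assms(3)] by (auto intro!: derivative_eq_intros)
  have eq: "u a + integral {a..z} v = u z" if "z \<in> {a..b}" for z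
  proof -
    have "(v has_integral (u z - u a)) {a..z}"
      by (rule has_integral_derivative[where S = "{}"])
         (use that C1_pairD[OF C1_pair_subinterval[OF assms(1), of a z]] in auto)
    then show ?thesis by (auto dest: integral_unique)
  qed
  show ?thesis
    by (rule has_field_derivative_transform_within[OF d zero_less_one assms(3)]) (rule eq)
qed

section \<open>The inequalities of Picone and Poincare\<close>

text \<open>
  Picone's identity: \<open>s'\<^sup>2 + q s\<^sup>2\<close> is the derivative of \<open>s\<^sup>2 v / u\<close> plus the square of
  \<open>s' - s v / u\<close>. Subtracting the derivative of \<open>Q s\<^sup>2\<close> trades the discontinuous \<open>q\<close> for the constant
  \<open>c\<close> and a cross term with the small continuous function \<open>Q\<close>.
\<close>
lemma picone_inequality:
  fixes s s' Q :: "real \<Rightarrow> real"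
  assumes fin: "finite S" and ab: "a \<le> b"
    and u: "C1_pair S a b u v (\<lambda>x. q x * u x)"
    and pos: "\<And>x. x \<in> {a..b} \<Longrightarrow> 0 < u x"
    and s: "continuous_on {a..b} s" "continuous_on {a..b} s'"
      "\<And>x. x \<in> {a<..<b} \<Longrightarrow> (s has_real_derivative s' x) (at x)" "s a = 0" "s b = 0"
    and Q: "continuous_on {a..b} Q"
      "\<And>x. x \<in> {a<..<b} - S \<Longrightarrow> (Q has_real_derivative q x - c) (at x)"
  shows "0 \<le> integral {a..b} (\<lambda>x. (s' x)\<^sup>2 + c * (s x)\<^sup>2 - 2 * Q x * s x * s' x)"
proof -
  note uv = C1_pairD[OF u]
  define G where "G x = (s' x)\<^sup>2 + c * (s x)\<^sup>2 - 2 * Q x * s x * s' x" for x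
  \<comment> \<open>\<open>q\<close> cancels in the derivative of \<open>F\<close>, so the remaining function \<open>G\<close> is continuous\<close>
  define F where "F x = (s x)\<^sup>2 * v x / u x - Q x * (s x)\<^sup>2" for x
  have ne: "\<And>x. x \<in> {a..b} \<Longrightarrow> u x \<noteq> 0" using pos by force
  have "F b - F a = 0" by (simp add: F_def s)
  have "((\<lambda>x. G x - (s' x - s x * v x / u x)\<^sup>2) has_integral (F b - F a)) {a..b}"
  proof (rule has_integral_derivative[OF fin ab])
    show "continuous_on {a..b} F"
      unfolding F_def by (intro continuous_intros uv s Q) (use ne in auto)
    fix x assume x: "x \<in> {a<..<b} - S"
    then have ux: "u x \<noteq> 0" using ne by auto
    have d: "(s has_real_derivative s' x) (at x)" "(u has_real_derivative v x) (at x)"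
      "(v has_real_derivative q x * u x) (at x)" "(Q has_real_derivative q x - c) (at x)"
      using x uv(3)[of x] uv(4)[OF x] s(3)[of x] Q(2)[OF x] by auto
    have d2: "((\<lambda>x. (s x)\<^sup>2) has_real_derivative 2 * s x * s' x) (at x)"
      by (rule derivative_eq_intros d refl)+ simp
    define w where "w = v x / u x"
    have w: "v x = w * u x" using ux by (simp add: w_def)
    have D: "(F has_real_derivative
        ((2 * s x * s' x * v x + q x * u x * (s x)\<^sup>2) * u x - (s x)\<^sup>2 * v x * v x) / (u x * u x)
        - ((q x - c) * (s x)\<^sup>2 + 2 * s x * s' x * Q x)) (at x)"
      unfolding F_def by (intro DERIV_diff DERIV_divide DERIV_mult d d2 ux)
    have e1: "((2 * s x * s' x * v x + q x * u x * (s x)\<^sup>2) * u x - (s x)\<^sup>2 * v x * v x) / (u x * u x)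
        = 2 * s x * s' x * w + q x * (s x)\<^sup>2 - (s x)\<^sup>2 * w\<^sup>2"
      unfolding w using ux by (simp add: field_simps power2_eq_square)
    have e2: "s x * v x / u x = s x * w" by (simp add: w_def)
    show "(F has_real_derivative G x - (s' x - s x * v x / u x)\<^sup>2) (at x)"
      by (rule DERIV_cong[OF D], unfold e1 e2 G_def) (simp add: power2_eq_square algebra_simps)
  qed
  moreover have "(G has_integral integral {a..b} G) {a..b}"
    unfolding G_def by (intro integrable_integral integrable_continuous_real continuous_intros s Q)
  moreover have "G x - (s' x - s x * v x / u x)\<^sup>2 \<le> G x" for x
    using zero_le_power2[of "s' x - s x * v x / u x"] by linarith
  ultimately have "F b - F a \<le> integral {a..b} G"
    by (rule has_integral_le)
  with \<open>F b - F a = 0\<close> have "0 \<le> integral {a..b} G" by simp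
  then show ?thesis by (simp add: G_def[abs_def])
qed

text \<open>
  Compare with the sine of a slightly longer interval, which is positive up to the end points of
  \<open>[0,L]\<close>, and let the extra length tend to \<open>0\<close>.
\<close>
lemma poincare_inequality:
  fixes s s' :: "real \<Rightarrow> real"
  assumes L: "0 < L"
    and s: "continuous_on {0..L} s" "continuous_on {0..L} s'"
      "\<And>x. x \<in> {0<..<L} \<Longrightarrow> (s has_real_derivative s' x) (at x)" "s 0 = 0" "s L = 0"
  shows "(pi / L)\<^sup>2 * integral {0..L} (\<lambda>x. (s x)\<^sup>2) \<le> integral {0..L} (\<lambda>x. (s' x)\<^sup>2)"
proof -
  have int: "(\<lambda>x. (s x)\<^sup>2) integrable_on {0..L}" "(\<lambda>x. (s' x)\<^sup>2) integrable_on {0..L}"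
    by (intro integrable_continuous_real continuous_intros s)+
  have *: "(pi / (L + 2 * e))\<^sup>2 * integral {0..L} (\<lambda>x. (s x)\<^sup>2) \<le> integral {0..L} (\<lambda>x. (s' x)\<^sup>2)"
    if e: "0 < e" for e
  proof -
    define \<theta> where "\<theta> = pi / (L + 2 * e)"
    have \<theta>: "\<theta> > 0" using L e by (auto simp: \<theta>_def)
    have "0 \<le> integral {0..L} (\<lambda>x. (s' x)\<^sup>2 + (- \<theta>\<^sup>2) * (s x)\<^sup>2 - 2 * 0 * s x * s' x)"
    proof (rule picone_inequality[where S = "{}" and u = "\<lambda>x. sin (\<theta> * (x + e))"
            and v = "\<lambda>x. \<theta> * cos (\<theta> * (x + e))" and q = "\<lambda>_. - \<theta>\<^sup>2" and Q = "\<lambda>_. 0"])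
      show "C1_pair {} 0 L (\<lambda>x. sin (\<theta> * (x + e))) (\<lambda>x. \<theta> * cos (\<theta> * (x + e)))
          (\<lambda>x. - \<theta>\<^sup>2 * sin (\<theta> * (x + e)))"
        unfolding C1_pair_def
        by (auto intro!: continuous_intros derivative_eq_intros simp: power2_eq_square)
      fix x assume x: "x \<in> {0..L}"
      have "\<theta> * (x + e) < \<theta> * (L + 2 * e)"
        using x e by (intro mult_strict_left_mono \<theta>) auto
      also have "\<dots> = pi" using L e by (simp add: \<theta>_def)
      finally show "0 < sin (\<theta> * (x + e))"
        using x e \<theta> by (intro sin_gt_zero) auto
    qed (use L s in auto)
    also have "\<dots> = integral {0..L} (\<lambda>x. (s' x)\<^sup>2) - \<theta>\<^sup>2 * integral {0..L} (\<lambda>x. (s x)\<^sup>2)"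
      using int by (simp add: integral_diff integrable_on_mult_right)
    finally show ?thesis by (simp add: \<theta>_def)
  qed
  have "((\<lambda>e. (pi / (L + 2 * e))\<^sup>2 * integral {0..L} (\<lambda>x. (s x)\<^sup>2)) \<longlongrightarrow>
      (pi / (L + 2 * 0))\<^sup>2 * integral {0..L} (\<lambda>x. (s x)\<^sup>2)) (at_right 0)"
    by (intro tendsto_intros) (use L in auto)
  moreover have "\<forall>\<^sub>F e in at_right (0::real).
      (pi / (L + 2 * e))\<^sup>2 * integral {0..L} (\<lambda>x. (s x)\<^sup>2) \<le> integral {0..L} (\<lambda>x. (s' x)\<^sup>2)"
    using * by (auto simp: eventually_at_filter)
  ultimately have "(pi / (L + 2 * 0))\<^sup>2 * integral {0..L} (\<lambda>x. (s x)\<^sup>2)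
      \<le> integral {0..L} (\<lambda>x. (s' x)\<^sup>2)"
    by (rule tendsto_upperbound) (rule trivial_limit_at_right_real)
  then show ?thesis by simp
qed

context potential begin

section \<open>The Dirichlet problem in terms of continuously differentiable pairs\<close>

lemma dirichlet_imp_C1_pair:
  assumes D: "dirichlet_schroedinger W L u f" and f: "\<And>x. f x = \<mu> * u x + c"
  obtains v where "C1_pair S 0 L u v (\<lambda>x. (W x - \<mu>) * u x - c)" "u 0 = 0" "u L = 0"
proof -
  obtain g v where uL: "u 0 = 0" "u L = 0"
    and g_meas: "set_borel_measurable lborel {0..L} g"
    and u': "\<And>x. x \<in> {0..L} \<Longrightarrow> (u has_real_derivative v x) (at x within {0..L})"
    and v: "\<And>x. x \<in> {0..L} \<Longrightarrow> v x = v 0 + (LINT t:{0..x}|lborel. g t)"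
    and ae: "AE x in lborel. x \<in> {0<..<L} \<longrightarrow> - g x + W x * u x = f x"
    using D unfolding dirichlet_schroedinger_def sobolev2_second_deriv_def by blast
  have uc: "continuous_on {0..L} u"
    unfolding continuous_on_eq_continuous_within by (intro ballI DERIV_continuous[OF u'])
  define h where "h x = (W x - \<mu>) * u x + (- c)" for x
  have h_int: "set_integrable lborel {0..L} h"
    unfolding h_def by (intro set_integral_add set_integrable_W uc borel_integrable_atLeastAtMost'
        continuous_intros)
  define g0 h0 where "g0 x = indicator {0..L} x *\<^sub>R g x" and "h0 x = indicator {0..L} x *\<^sub>R h x" for x
  have [measurable]: "g0 \<in> borel_measurable lborel"
    using g_meas by (simp add: set_borel_measurable_def g0_def[abs_def])
  have [measurable]: "h0 \<in> borel_measurable lborel"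
    using h_int unfolding set_integrable_def h0_def[abs_def] by (rule borel_measurable_integrable)
  have ae': "AE x in lborel. g0 x = h0 x"
    using ae AE_lborel_singleton[of 0] AE_lborel_singleton[of L]
    by eventually_elim (auto simp: h_def f g0_def h0_def indicator_def algebra_simps)
  have eq: "(LINT t:{0..x}|lborel. g t) = integral {0..x} h" if x: "x \<in> {0..L}" for x
  proof -
    have sub: "{0..x} \<subseteq> {0..L}" using x by auto
    have ind: "indicator {0..x} t *\<^sub>R g t = indicator {0..x} t *\<^sub>R g0 t"
      "indicator {0..x} t *\<^sub>R h t = indicator {0..x} t *\<^sub>R h0 t" for t
      using sub by (auto simp: indicator_def g0_def h0_def)
    have "(LINT t:{0..x}|lborel. g t) = (LINT t:{0..x}|lborel. h t)"
      unfolding set_lebesgue_integral_def ind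
    proof (rule integral_cong_AE)
      show "AE t in lborel. indicator {0..x} t *\<^sub>R g0 t = indicator {0..x} t *\<^sub>R h0 t"
        using ae' by eventually_elim simp
    qed measurable
    also have "\<dots> = integral {0..x} h"
      by (rule set_borel_integral_eq_integral, rule set_integrable_subset[OF h_int])
         (use sub in auto)
    finally show ?thesis .
  qed
  note prim = primitive_W(1)[OF uc, of "\<lambda>_. - c" \<mu>] primitive_W(2)[OF uc, of "\<lambda>_. - c" _ \<mu>]
  have hc: "continuous_on {0..L} (\<lambda>x. integral {0..x} h)"
    and hd: "\<And>x. x \<in> {0<..<L} - S \<Longrightarrow> ((\<lambda>x. integral {0..x} h) has_real_derivative h x) (at x)"
    using prim unfolding h_def[abs_def] by auto
  have vv: "v 0 + integral {0..z} h = v z" if "z \<in> {0..L}" for z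
    using v[OF that] eq[OF that] by linarith
  have "continuous_on {0..L} (\<lambda>x. v 0 + integral {0..x} h)" by (intro continuous_intros hc)
  then have vc: "continuous_on {0..L} v"
    by (rule continuous_on_eq) (rule vv)
  have "C1_pair S 0 L u v h"
    unfolding C1_pair_def
  proof (intro conjI ballI uc vc)
    fix x assume x: "x \<in> {0<..<L}"
    show "(u has_real_derivative v x) (at x)"
      using u'[of x] x by (simp add: at_within_Icc_at)
  next
    fix x assume x: "x \<in> {0<..<L} - S"
    have "((\<lambda>x. v 0 + integral {0..x} h) has_real_derivative h x) (at x)"
      using hd[OF x] by (auto intro!: derivative_eq_intros)
    then show "(v has_real_derivative h x) (at x)"
      by (rule has_field_derivative_transform_within_open[where S = "{0<..<L}"])
         (use x vv in auto)
  qed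
  then show ?thesis using that uL by (simp add: h_def[abs_def])
qed

lemma C1_pair_imp_dirichlet:
  assumes uv: "C1_pair S 0 L u v (\<lambda>x. (W x - \<mu>) * u x - c)" and uL: "u 0 = 0" "u L = 0"
    and f: "\<And>x. f x = \<mu> * u x + c"
  shows "dirichlet_schroedinger W L u f"
proof -
  note c = C1_pairD[OF uv]
  define g where "g x = (W x - \<mu>) * u x - c" for x
  have g_int: "set_integrable lborel {0..L} g"
    unfolding g_def by (intro set_integral_diff set_integrable_W c borel_integrable_atLeastAtMost'
        continuous_intros)
  have g_meas: "set_borel_measurable lborel {0..L} g"
    using g_int unfolding set_integrable_def set_borel_measurable_def
    by (rule borel_measurable_integrable)
  have "set_integrable lborel {0..L} (\<lambda>x. (g x)\<^sup>2)"
  proof (rule set_integrable_bound)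
    show "set_integrable lborel {0..L} (\<lambda>x. ((B + \<bar>\<mu>\<bar>) * \<bar>u x\<bar> + \<bar>c\<bar>)\<^sup>2)"
      by (intro borel_integrable_atLeastAtMost' continuous_intros c)
    have "(\<lambda>x. (indicator {0..L} x *\<^sub>R g x)\<^sup>2) \<in> borel_measurable lborel"
      using g_meas by (auto simp: set_borel_measurable_def)
    also have "(\<lambda>x. (indicator {0..L} x *\<^sub>R g x)\<^sup>2) = (\<lambda>x. indicator {0..L} x *\<^sub>R (g x)\<^sup>2)"
      by (auto simp: indicator_def)
    finally show "set_borel_measurable lborel {0..L} (\<lambda>x. (g x)\<^sup>2)"
      by (simp add: set_borel_measurable_def)
    have "\<bar>g x\<bar> \<le> (B + \<bar>\<mu>\<bar>) * \<bar>u x\<bar> + \<bar>c\<bar>" for x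
    proof -
      have "\<bar>W x - \<mu>\<bar> * \<bar>u x\<bar> \<le> (B + \<bar>\<mu>\<bar>) * \<bar>u x\<bar>"
        by (rule mult_right_mono) (use W_nonneg[of x] W_le[of x] in auto)
      then show ?thesis
        using abs_triangle_ineq4[of "(W x - \<mu>) * u x" c] by (simp add: g_def abs_mult)
    qed
    then have "\<bar>g x\<bar>\<^sup>2 \<le> ((B + \<bar>\<mu>\<bar>) * \<bar>u x\<bar> + \<bar>c\<bar>)\<^sup>2" for x
      by (rule power_mono) simp
    then show "AE x in lborel. x \<in> {0..L} \<longrightarrow> norm ((g x)\<^sup>2) \<le> norm (((B + \<bar>\<mu>\<bar>) * \<bar>u x\<bar> + \<bar>c\<bar>)\<^sup>2)"
      by simp
  qed
  moreover have "(u has_real_derivative v x) (at x within {0..L})" if "x \<in> {0..L}" for x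
    by (rule C1_pair_endpoint_derivative[OF uv L_pos that])
  moreover have "v x = v 0 + (LINT t:{0..x}|lborel. g t)" if x: "x \<in> {0..L}" for x
  proof -
    have "(g has_integral (v x - v 0)) {0..x}"
      by (rule has_integral_derivative[OF fin])
         (use x C1_pairD[OF C1_pair_subinterval[OF uv, of 0 x]] in \<open>auto simp: g_def\<close>)
    moreover have "(LINT t:{0..x}|lborel. g t) = integral {0..x} g"
      by (rule set_borel_integral_eq_integral, rule set_integrable_subset[OF g_int]) (use x in auto)
    ultimately show ?thesis by (auto dest: integral_unique)
  qed
  ultimately have "sobolev2_second_deriv L u g"
    using g_meas unfolding sobolev2_second_deriv_def by blast
  moreover have "AE x in lborel. x \<in> {0<..<L} \<longrightarrow> - g x + W x * u x = f x"
    by (auto simp: g_def f algebra_simps)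
  ultimately show ?thesis using uL unfolding dirichlet_schroedinger_def by blast
qed

end

section \<open>The ground state\<close>

lemma integral_sin_cos_profile:
  fixes c e \<alpha> \<beta> :: real
  assumes "\<alpha> < \<beta>"
  defines "\<theta> \<equiv> pi / (\<beta> - \<alpha>)"
  shows "((\<lambda>x. c * (cos (\<theta> * (x - \<alpha>)))\<^sup>2 + e * (sin (\<theta> * (x - \<alpha>)))\<^sup>2)
           has_integral (c + e) / 2 * (\<beta> - \<alpha>)) {\<alpha>..\<beta>}"
proof -
  have \<theta>: "\<theta> \<noteq> 0" using assms by (simp add: \<theta>_def)
  have at_end: "\<theta> * (\<beta> - \<alpha>) = pi" using assms by (simp add: \<theta>_def)
  define F where "F x = (c + e) / 2 * x + (c - e) / (2 * \<theta>) * (sin (\<theta> * (x - \<alpha>)) * cos (\<theta> * (x - \<alpha>)))" for x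
  have "((\<lambda>x. c * (cos (\<theta> * (x - \<alpha>)))\<^sup>2 + e * (sin (\<theta> * (x - \<alpha>)))\<^sup>2) has_integral (F \<beta> - F \<alpha>)) {\<alpha>..\<beta>}"
  proof (rule has_integral_derivative[where S = "{}"])
    show "continuous_on {\<alpha>..\<beta>} F" unfolding F_def by (intro continuous_intros)
    fix x
    have "(F has_real_derivative (c + e) / 2 + (c - e) / (2 * \<theta>) *
        (\<theta> * cos (\<theta> * (x - \<alpha>)) * cos (\<theta> * (x - \<alpha>)) - sin (\<theta> * (x - \<alpha>)) * (\<theta> * sin (\<theta> * (x - \<alpha>))))) (at x)"
      unfolding F_def
    proof (intro DERIV_add DERIV_cmult)
      show "((\<lambda>x. (c + e) / 2 * x) has_real_derivative (c + e) / 2) (at x)"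
        by (auto intro!: derivative_eq_intros)
      show "((\<lambda>x. sin (\<theta> * (x - \<alpha>)) * cos (\<theta> * (x - \<alpha>))) has_real_derivative
        \<theta> * cos (\<theta> * (x - \<alpha>)) * cos (\<theta> * (x - \<alpha>)) - sin (\<theta> * (x - \<alpha>)) * (\<theta> * sin (\<theta> * (x - \<alpha>)))) (at x)"
        by (auto intro!: derivative_eq_intros simp: algebra_simps)
    qed
    also have "(c - e) / (2 * \<theta>) *
        (\<theta> * cos (\<theta> * (x - \<alpha>)) * cos (\<theta> * (x - \<alpha>)) - sin (\<theta> * (x - \<alpha>)) * (\<theta> * sin (\<theta> * (x - \<alpha>))))
      = (c - e) / 2 * ((cos (\<theta> * (x - \<alpha>)))\<^sup>2 - (sin (\<theta> * (x - \<alpha>)))\<^sup>2)"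
      using \<theta> by (simp add: field_simps power2_eq_square)
    also have "(c + e) / 2 + (c - e) / 2 * ((cos (\<theta> * (x - \<alpha>)))\<^sup>2 - (sin (\<theta> * (x - \<alpha>)))\<^sup>2)
      = c * (cos (\<theta> * (x - \<alpha>)))\<^sup>2 + e * (sin (\<theta> * (x - \<alpha>)))\<^sup>2"
      unfolding sin_squared_eq by (simp add: field_simps)
    finally show "(F has_real_derivative c * (cos (\<theta> * (x - \<alpha>)))\<^sup>2 + e * (sin (\<theta> * (x - \<alpha>)))\<^sup>2) (at x)" .
  qed (use assms in auto)
  moreover have "F \<beta> - F \<alpha> = (c + e) / 2 * (\<beta> - \<alpha>)"
    unfolding F_def at_end by (simp add: algebra_simps diff_divide_distrib)
  ultimately show ?thesis by simp
qed

context potential begin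

text \<open>
  Picone's inequality with half a sine wave on \<open>[\<alpha>,\<beta>]\<close> as test function. The point of a subinterval
  is that the ground state vanishes at \<open>0\<close> and \<open>L\<close> but is positive on closed intervals inside, so
  that the division by \<open>u\<close> meets no singularity.
\<close>
lemma eigenvalue_le_of_positive:
  assumes u: "C1_pair S \<alpha> \<beta> u v (\<lambda>x. (W x - \<mu>) * u x)"
    and pos: "\<And>x. x \<in> {\<alpha>..\<beta>} \<Longrightarrow> 0 < u x" and ab: "0 \<le> \<alpha>" "\<alpha> < \<beta>" "\<beta> \<le> L"
    and Q: "continuous_on {0..L} Q"
      "\<And>x. x \<in> {0<..<L} - S \<Longrightarrow> (Q has_real_derivative W x - a) (at x)"
    and q: "\<And>x. x \<in> {0..L} \<Longrightarrow> \<bar>Q x\<bar> \<le> \<eta> / L"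
  shows "\<mu> \<le> (1 + \<eta>) * (pi / (\<beta> - \<alpha>))\<^sup>2 + a + \<eta> / L\<^sup>2"
proof -
  define \<theta> where "\<theta> = pi / (\<beta> - \<alpha>)"
  define s s' where "s x = sin (\<theta> * (x - \<alpha>))" and "s' x = \<theta> * cos (\<theta> * (x - \<alpha>))" for x
  have Qc: "continuous_on {\<alpha>..\<beta>} Q" by (rule continuous_on_subset[OF Q(1)]) (use ab in auto)
  have sc: "continuous_on {\<alpha>..\<beta>} s" "continuous_on {\<alpha>..\<beta>} s'"
    unfolding s_def s'_def by (intro continuous_intros)+
  have "0 \<le> integral {\<alpha>..\<beta>} (\<lambda>x. (s' x)\<^sup>2 + (a - \<mu>) * (s x)\<^sup>2 - 2 * Q x * s x * s' x)"
  proof (rule picone_inequality[OF fin _ u pos sc _ _ _ Qc])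
    show "(s has_real_derivative s' x) (at x)" for x
      unfolding s_def s'_def by (auto intro!: derivative_eq_intros)
    show "s \<beta> = 0" using ab by (simp add: s_def \<theta>_def)
    fix x assume "x \<in> {\<alpha><..<\<beta>} - S"
    then show "(Q has_real_derivative W x - \<mu> - (a - \<mu>)) (at x)"
      using Q(2)[of x] ab by auto
  qed (use ab in \<open>auto simp: s_def\<close>)
  also have "\<dots> \<le> integral {\<alpha>..\<beta>} (\<lambda>x. (1 + \<eta>) * \<theta>\<^sup>2 * (cos (\<theta> * (x - \<alpha>)))\<^sup>2
      + (a - \<mu> + \<eta> / L\<^sup>2) * (sin (\<theta> * (x - \<alpha>)))\<^sup>2)"
  proof (rule integral_le)
    fix x assume "x \<in> {\<alpha>..\<beta>}"
    then have x: "x \<in> {0..L}" using ab by auto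
    have "- (2 * Q x * s x * s' x) \<le> \<bar>Q x\<bar> * (2 * \<bar>s x\<bar> * \<bar>s' x\<bar>)"
      by (rule order_trans[OF abs_ge_self]) (simp add: abs_mult)
    also have "\<dots> \<le> \<eta> / L * (2 * \<bar>s x\<bar> * \<bar>s' x\<bar>)" by (rule mult_right_mono[OF q[OF x]]) simp
    also have "\<dots> = \<eta> * (2 * (\<bar>s x\<bar> / L) * \<bar>s' x\<bar>)" by simp
    also have "\<dots> \<le> \<eta> * ((\<bar>s x\<bar> / L)\<^sup>2 + \<bar>s' x\<bar>\<^sup>2)"
    proof (rule mult_left_mono[OF sum_squares_bound])
      show "0 \<le> \<eta>" using order_trans[OF abs_ge_zero q[OF x]] L_pos by (simp add: zero_le_divide_iff)
    qed
    finally show "(s' x)\<^sup>2 + (a - \<mu>) * (s x)\<^sup>2 - 2 * Q x * s x * s' x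
      \<le> (1 + \<eta>) * \<theta>\<^sup>2 * (cos (\<theta> * (x - \<alpha>)))\<^sup>2 + (a - \<mu> + \<eta> / L\<^sup>2) * (sin (\<theta> * (x - \<alpha>)))\<^sup>2"
      by (simp add: s_def s'_def power_mult_distrib power_divide algebra_simps)
  qed (intro integrable_continuous_real continuous_intros sc Qc)+
  also have "\<dots> = ((1 + \<eta>) * \<theta>\<^sup>2 + (a - \<mu> + \<eta> / L\<^sup>2)) / 2 * (\<beta> - \<alpha>)"
    unfolding \<theta>_def by (rule integral_unique[OF integral_sin_cos_profile[OF ab(2)]])
  finally have "0 \<le> (1 + \<eta>) * \<theta>\<^sup>2 + (a - \<mu> + \<eta> / L\<^sup>2)"
    using ab by (simp add: zero_le_mult_iff)
  then show ?thesis by (simp add: \<theta>_def)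
qed

definition shoot_positive :: "real set" where
  "shoot_positive = {\<mu>. \<forall>x\<in>{0<..L}. 0 < sol \<mu> x}"

lemma positive_near_0:
  assumes "0 < \<delta>" "\<delta> \<le> L" "\<And>x. x \<in> {0..\<delta>} \<Longrightarrow> 0 < sol' \<mu> x" "x \<in> {0<..\<delta>}"
  shows "0 < sol \<mu> x"
proof -
  note p = C1_pairD[OF shoot_pair[of \<mu>]]
  have c: "continuous_on {0..x} (sol \<mu>)" using p(1) by (rule continuous_on_subset) (use assms in auto)
  have "\<exists>l z. 0 < z \<and> z < x \<and> (sol \<mu> has_real_derivative l) (at z) \<and> sol \<mu> x - sol \<mu> 0 = (x - 0) * l"
  proof (rule MVT)
    show "0 < x" using assms by simp
    show "continuous_on {0..x} (sol \<mu>)" by (rule c)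
    fix z assume "0 < z" "z < x"
    then show "sol \<mu> differentiable (at z)"
      using p(3)[of z] assms unfolding real_differentiable_def by auto
  qed
  then obtain l z where z: "0 < z" "z < x" "(sol \<mu> has_real_derivative l) (at z)" "sol \<mu> x = x * l"
    by (auto simp: sol_0)
  have "l = sol' \<mu> z" using DERIV_unique[OF z(3) p(3)] z assms by auto
  then show ?thesis using z assms by auto
qed

lemma slope_near_0:
  obtains \<delta> where "0 < \<delta>" "\<delta> \<le> L" "\<And>x. x \<in> {0..\<delta>} \<Longrightarrow> 1/2 < sol' \<mu> x"
proof -
  have "continuous_on {0..L} (sol' \<mu>)" by (rule C1_pairD[OF shoot_pair])
  then have "\<exists>d>0. \<forall>x\<in>{0..L}. dist x 0 < d \<longrightarrow> dist (sol' \<mu> x) (sol' \<mu> 0) < 1/2"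
    unfolding continuous_on_iff
    by (meson L_pos atLeastAtMost_iff half_gt_zero less_imp_le order_refl zero_less_one)
  then obtain d where d: "d > 0" "\<And>x. x \<in> {0..L} \<Longrightarrow> x < d \<Longrightarrow> \<bar>sol' \<mu> x - 1\<bar> < 1/2"
    by (auto simp: dist_real_def sol'_0)
  show ?thesis
  proof (rule that[of "min (d/2) L"])
    fix x assume "x \<in> {0..min (d/2) L}"
    then have "\<bar>sol' \<mu> x - 1\<bar> < 1/2" using d(1) by (intro d(2)) auto
    then show "1/2 < sol' \<mu> x" by linarith
  qed (use d L_pos in auto)
qed

text \<open>
  Near \<open>0\<close>, where the shooting function itself has no positive lower bound, positivity is kept
  through a lower bound on its slope; away from \<open>0\<close> the function is bounded below.
\<close>
lemma shoot_positive_open: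
  assumes \<nu>: "\<nu> \<in> shoot_positive"
  shows "\<exists>d>0. \<forall>\<mu>. \<bar>\<mu> - \<nu>\<bar> < d \<longrightarrow> \<mu> \<in> shoot_positive"
proof -
  note p = C1_pairD[OF shoot_pair[of \<nu>]]
  obtain \<delta> where \<delta>: "0 < \<delta>" "\<delta> \<le> L" "\<And>x. x \<in> {0..\<delta>} \<Longrightarrow> 1/2 < sol' \<nu> x"
    using slope_near_0[of \<nu>] by blast
  have "continuous_on {\<delta>..L} (sol \<nu>)" using p(1) by (rule continuous_on_subset) (use \<delta> in auto)
  then obtain x0 where x0: "x0 \<in> {\<delta>..L}" "\<And>x. x \<in> {\<delta>..L} \<Longrightarrow> sol \<nu> x0 \<le> sol \<nu> x"
    using continuous_attains_inf[of "{\<delta>..L}" "sol \<nu>"] \<delta> by auto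
  have m: "0 < sol \<nu> x0" using \<nu> x0(1) \<delta> by (auto simp: shoot_positive_def)
  define e where "e = min (1/4) (sol \<nu> x0)"
  have e: "0 < e" using m by (simp add: e_def)
  obtain d where d: "d > 0" "\<And>\<mu> x. \<bar>\<mu> - \<nu>\<bar> < d \<Longrightarrow> x \<in> {0..L} \<Longrightarrow>
      \<bar>sol \<mu> x - sol \<nu> x\<bar> < e \<and> \<bar>sol' \<mu> x - sol' \<nu> x\<bar> < e"
    using shoot_continuous_in_eigenvalue[OF e, of \<nu>] by blast
  show ?thesis
  proof (intro exI[of _ d] conjI d(1) allI impI)
    fix \<mu> assume \<mu>: "\<bar>\<mu> - \<nu>\<bar> < d"
    have slope: "0 < sol' \<mu> x" if "x \<in> {0..\<delta>}" for x
    proof -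
      have "\<bar>sol' \<mu> x - sol' \<nu> x\<bar> < e" using d(2)[OF \<mu>, of x] that \<delta> by auto
      moreover have "e \<le> 1/4" by (simp add: e_def)
      ultimately show ?thesis using \<delta>(3)[OF that] by linarith
    qed
    have "0 < sol \<mu> x" if x: "x \<in> {0<..L}" for x
    proof (cases "x \<le> \<delta>")
      case True
      then show ?thesis using positive_near_0[OF \<delta>(1,2) slope] x by auto
    next
      case False
      then have "sol \<nu> x0 \<le> sol \<nu> x" using x x0(2)[of x] by auto
      moreover have "\<bar>sol \<mu> x - sol \<nu> x\<bar> < e" using d(2)[OF \<mu>, of x] x by auto
      moreover have "e \<le> sol \<nu> x0" by (simp add: e_def)
      ultimately show ?thesis by linarith
    qed
    then show "\<mu> \<in> shoot_positive" by (simp add: shoot_positive_def)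
  qed
qed

text \<open>
  For \<open>\<mu> \<le> 0\<close> the product \<open>y y'\<close> has derivative \<open>y'\<^sup>2 + (W - \<mu>) y\<^sup>2 \<ge> y'\<^sup>2\<close>. If \<open>y\<close> had a zero
  \<open>x > 0\<close>, then \<open>y y'\<close> would vanish at \<open>0\<close> and at \<open>x\<close>, which forces \<open>y' = 0\<close> on \<open>[0,x]\<close>, against
  \<open>y'(0) = 1\<close>.
\<close>
lemma nonpos_in_shoot_positive:
  assumes "\<mu> \<le> 0"
  shows "\<mu> \<in> shoot_positive"
proof -
  note p = C1_pairD[OF shoot_pair[of \<mu>]]
  have nz: "sol \<mu> x \<noteq> 0" if x: "x \<in> {0<..L}" for x
  proof
    assume z: "sol \<mu> x = 0"
    note px = C1_pairD[OF C1_pair_subinterval[OF shoot_pair[of \<mu>], of 0 x]]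
    have "((\<lambda>r. (sol' \<mu> r)\<^sup>2 + (W r - \<mu>) * (sol \<mu> r)\<^sup>2) has_integral
        (sol \<mu> x * sol' \<mu> x - sol \<mu> 0 * sol' \<mu> 0)) {0..x}"
    proof (rule has_integral_derivative[OF fin])
      show "continuous_on {0..x} (\<lambda>r. sol \<mu> r * sol' \<mu> r)"
        using x by (intro continuous_intros px) auto
      fix r assume r: "r \<in> {0<..<x} - S"
      show "((\<lambda>r. sol \<mu> r * sol' \<mu> r) has_real_derivative
          (sol' \<mu> r)\<^sup>2 + (W r - \<mu>) * (sol \<mu> r)\<^sup>2) (at r)"
        using p(3)[of r] p(4)[of r] r x
        by (auto intro!: derivative_eq_intros simp: power2_eq_square)
    qed (use x in auto)
    then have zero: "((\<lambda>r. (sol' \<mu> r)\<^sup>2 + (W r - \<mu>) * (sol \<mu> r)\<^sup>2) has_integral 0) {0..x}"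
      by (simp add: z sol_0)
    have c: "continuous_on {0..x} (\<lambda>r. (sol' \<mu> r)\<^sup>2)"
      using x by (intro continuous_intros px) auto
    have "((\<lambda>r. (sol' \<mu> r)\<^sup>2) has_integral integral {0..x} (\<lambda>r. (sol' \<mu> r)\<^sup>2)) {0..x}"
      by (intro integrable_integral integrable_continuous_real c)
    then have "integral {0..x} (\<lambda>r. (sol' \<mu> r)\<^sup>2) \<le> 0"
    proof (rule has_integral_le[OF _ zero])
      fix r
      have "0 \<le> (W r - \<mu>) * (sol \<mu> r)\<^sup>2"
        by (intro mult_nonneg_nonneg) (use assms W_nonneg[of r] in auto)
      then show "(sol' \<mu> r)\<^sup>2 \<le> (sol' \<mu> r)\<^sup>2 + (W r - \<mu>) * (sol \<mu> r)\<^sup>2" by simp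
    qed
    moreover have "integral {0..x} (\<lambda>r. (sol' \<mu> r)\<^sup>2) \<ge> 0"
      by (intro integral_nonneg integrable_continuous_real c) auto
    ultimately have "integral {0..x} (\<lambda>r. (sol' \<mu> r)\<^sup>2) = 0" by simp
    then have "(sol' \<mu> 0)\<^sup>2 = 0"
      using integral_eq_0_iff[OF c] x by auto
    then show False by (simp add: sol'_0)
  qed
  obtain \<delta> where \<delta>: "0 < \<delta>" "\<delta> \<le> L" "\<And>x. x \<in> {0..\<delta>} \<Longrightarrow> 1/2 < sol' \<mu> x"
    using slope_near_0[of \<mu>] by blast
  have "0 < sol \<mu> x" if x: "x \<in> {0<..L}" for x
  proof (rule ccontr)
    assume neg: "\<not> 0 < sol \<mu> x"
    define z where "z = min \<delta> x"
    have z: "0 < sol \<mu> z" "0 < z" "z \<le> x"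
      using positive_near_0[OF \<delta>(1,2), of \<mu> z] \<delta> x by (force simp: z_def)+
    have "continuous_on {z..x} (sol \<mu>)"
      by (rule continuous_on_subset[OF p(1)]) (use z x in auto)
    then obtain r where "z \<le> r" "r \<le> x" "sol \<mu> r = 0"
      using IVT2'[of "sol \<mu>" x 0 z] neg z by auto
    then show False using nz[of r] z x by auto
  qed
  then show ?thesis by (simp add: shoot_positive_def)
qed

lemma shoot_positive_bounded: "\<exists>b. \<forall>\<mu>\<in>shoot_positive. \<mu> \<le> b"
proof -
  define Q where "Q x = integral {0..x} (\<lambda>r. (W r - 0) * 1 + 0)" for x
  have Qc: "continuous_on {0..L} Q"
    and Qd: "\<And>x. x \<in> {0<..<L} - S \<Longrightarrow> (Q has_real_derivative W x - 0) (at x)"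
    using primitive_W(1)[of "\<lambda>_. 1" "\<lambda>_. 0" 0] primitive_W(2)[of "\<lambda>_. 1" "\<lambda>_. 0" _ 0]
    by (auto simp: Q_def[abs_def])
  have "bounded (Q ` {0..L})"
    by (intro compact_imp_bounded compact_continuous_image Qc compact_Icc)
  then obtain q where "\<forall>z\<in>Q ` {0..L}. norm z \<le> q" unfolding bounded_iff by blast
  then have q: "\<And>x. x \<in> {0..L} \<Longrightarrow> \<bar>Q x\<bar> \<le> q" by auto
  \<comment> \<open>any fixed subinterval away from \<open>0\<close> serves, and any bound on \<open>Q\<close>\<close>
  have "\<mu> \<le> (1 + q * L) * (pi / (L - L / 2))\<^sup>2 + 0 + (q * L) / L\<^sup>2" if "\<mu> \<in> shoot_positive" for \<mu>
  proof (rule eigenvalue_le_of_positive[OF _ _ _ _ _ Qc Qd])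
    show "C1_pair S (L/2) L (sol \<mu>) (sol' \<mu>) (\<lambda>x. (W x - \<mu>) * sol \<mu> x)"
      by (rule C1_pair_subinterval[OF shoot_pair]) (use L_pos in auto)
  qed (use that L_pos q in \<open>auto simp: shoot_positive_def\<close>)
  then show ?thesis by blast
qed

text \<open>
  The Wronskian with the solution \<open>z\<close> satisfying \<open>z(0) = 1\<close> and \<open>z'(0) = 0\<close> is constant and equal to
  \<open>1\<close>; a double zero would make it vanish.
\<close>
lemma slope_nonzero_at_zero:
  assumes x: "x \<in> {0..L}" and zero: "sol \<mu> x = 0"
  shows "sol' \<mu> x \<noteq> 0"
proof
  assume zero': "sol' \<mu> x = 0"
  obtain z w where "C1_pair S 0 L z w (\<lambda>x. (W x - \<mu>) * z x + 0)" "z 0 = 1" "w 0 = 0"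
    by (rule ivp_solution)
  then have zw: "C1_pair S 0 L z w (\<lambda>x. (W x - \<mu>) * z x)" and z0: "z 0 = 1" by simp_all
  define F where "F r = sol' \<mu> r * z r - sol \<mu> r * w r" for r
  note p = C1_pairD[OF C1_pair_subinterval[OF shoot_pair[of \<mu>], of 0 x]]
  note q = C1_pairD[OF C1_pair_subinterval[OF zw, of 0 x]]
  have "((\<lambda>r. 0) has_integral (F x - F 0)) {0..x}"
  proof (rule has_integral_derivative[OF fin])
    show "continuous_on {0..x} F" unfolding F_def using x by (intro continuous_intros p q) auto
    fix r assume r: "r \<in> {0<..<x} - S"
    show "(F has_real_derivative 0) (at r)"
      unfolding F_def using p(3)[of r] p(4)[of r] q(3)[of r] q(4)[of r] r x
      by (auto intro!: derivative_eq_intros simp: algebra_simps)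
  qed (use x in auto)
  then have "F x - F 0 = 0" using has_integral_0 has_integral_unique by blast
  then show False by (simp add: F_def zero zero' sol_0 sol'_0 z0)
qed

text \<open>
  Let \<open>E\<close> be the infimum of the parameters for which the shooting function is not positive on
  \<open>(0,L]\<close>. By openness \<open>E\<close> is itself such a parameter, and as a limit of positive functions
  \<open>y\<^sub>E \<ge> 0\<close>. So \<open>y\<^sub>E\<close> has a zero in \<open>(0,L]\<close>; an interior zero would be a minimum, hence a double
  zero, which is impossible. The zero is therefore \<open>L\<close>, which makes \<open>E\<close> an eigenvalue with a
  positive eigenfunction. No smaller eigenvalue exists, because below \<open>E\<close> the shooting function is
  positive at \<open>L\<close>.
\<close>
lemma ground_state:
  obtains \<phi> \<phi>' where
    "C1_pair S 0 L \<phi> \<phi>' (\<lambda>x. (W x - ground_state_eigenvalue W L) * \<phi> x)"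
    "\<phi> 0 = 0" "\<phi> L = 0" "\<And>x. x \<in> {0<..<L} \<Longrightarrow> 0 < \<phi> x"
proof -
  define N where "N = - shoot_positive"
  obtain b where b: "\<And>\<mu>. \<mu> \<in> shoot_positive \<Longrightarrow> \<mu> \<le> b" using shoot_positive_bounded by blast
  have N_ne: "N \<noteq> {}" using b[of "b + 1"] by (auto simp: N_def)
  have N_ge: "0 \<le> \<mu>" if "\<mu> \<in> N" for \<mu>
    using nonpos_in_shoot_positive[of \<mu>] that by (force simp: N_def)
  then have bdd: "bdd_below N" by (intro bdd_belowI)
  define E where "E = Inf N"
  have below: "\<mu> \<in> shoot_positive" if "\<mu> < E" for \<mu>
    using cInf_lower[OF _ bdd, of \<mu>] that by (force simp: E_def N_def)
  have E_N: "E \<notin> shoot_positive"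
  proof
    assume "E \<in> shoot_positive"
    then obtain d where d: "d > 0" "\<And>\<mu>. \<bar>\<mu> - E\<bar> < d \<Longrightarrow> \<mu> \<in> shoot_positive"
      using shoot_positive_open by blast
    obtain \<mu> where \<mu>: "\<mu> \<in> N" "\<mu> < E + d"
      using cInf_lessD[OF N_ne, of "E + d"] d by (auto simp: E_def)
    moreover have "E \<le> \<mu>" using cInf_lower[OF \<mu>(1) bdd] by (simp add: E_def)
    ultimately show False using d(2)[of \<mu>] by (auto simp: N_def)
  qed
  have nonneg: "0 \<le> sol E x" if x: "x \<in> {0..L}" for x
  proof (rule field_le_epsilon)
    fix e :: real assume e: "0 < e"
    then obtain d where d: "d > 0" "\<And>\<mu> x. \<bar>\<mu> - E\<bar> < d \<Longrightarrow> x \<in> {0..L} \<Longrightarrow> \<bar>sol \<mu> x - sol E x\<bar> < e"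
      using shoot_continuous_in_eigenvalue[OF e, of E] by blast
    have "\<bar>sol (E - d/2) x - sol E x\<bar> < e" using d(2)[of "E - d/2" x] d(1) x by auto
    moreover have "0 \<le> sol (E - d/2) x"
      using below[of "E - d/2"] d(1) x
      by (cases "x = 0") (auto simp: sol_0 shoot_positive_def intro: less_imp_le)
    ultimately show "0 \<le> sol E x + e" by (simp add: abs_less_iff)
  qed
  note p = C1_pairD[OF shoot_pair[of E]]
  have interior: "0 < sol E x" if x: "x \<in> {0<..<L}" for x
  proof (rule ccontr)
    assume "\<not> 0 < sol E x"
    then have z: "sol E x = 0" using nonneg[of x] x by auto
    have "sol' E x = 0"
    proof (rule DERIV_local_min)
      show "(sol E has_real_derivative sol' E x) (at x)" by (rule p(3)[OF x])
      show "0 < min x (L - x)" using x by auto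
      show "\<forall>r. \<bar>x - r\<bar> < min x (L - x) \<longrightarrow> sol E x \<le> sol E r"
        using z nonneg by (auto simp: abs_less_iff)
    qed
    then show False using slope_nonzero_at_zero[OF _ z] x by auto
  qed
  have at_end: "sol E L = 0"
  proof -
    obtain x where "x \<in> {0<..L}" "\<not> 0 < sol E x" using E_N by (auto simp: shoot_positive_def)
    then have "x = L" using interior[of x] by (cases "x = L") auto
    then show ?thesis using \<open>\<not> 0 < sol E x\<close> nonneg[of L] L_pos by auto
  qed
  have "ground_state_eigenvalue W L = E"
    unfolding ground_state_eigenvalue_def
  proof (rule Least_equality)
    have "dirichlet_schroedinger W L (sol E) (\<lambda>x. E * sol E x)"
      by (rule C1_pair_imp_dirichlet[where c = 0 and \<mu> = E and v = "sol' E"])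
         (use shoot_pair[of E] at_end sol_0 in auto)
    moreover have "sol E (L/2) \<noteq> 0" using interior[of "L/2"] L_pos by auto
    ultimately show "dirichlet_eigenvalue W L E"
      unfolding dirichlet_eigenvalue_def using L_pos
      by (intro exI[of _ "sol E"] conjI bexI[of _ "L/2"]) auto
  next
    fix \<mu> assume "dirichlet_eigenvalue W L \<mu>"
    then obtain \<phi> x where x: "x \<in> {0<..<L}" "\<phi> x \<noteq> 0"
      and D: "dirichlet_schroedinger W L \<phi> (\<lambda>x. \<mu> * \<phi> x)"
      unfolding dirichlet_eigenvalue_def by blast
    obtain v where v: "C1_pair S 0 L \<phi> v (\<lambda>x. (W x - \<mu>) * \<phi> x)" "\<phi> 0 = 0" "\<phi> L = 0"
      using dirichlet_imp_C1_pair[OF D, of \<mu> 0] by auto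
    note eq = ivp_eq_shoot[OF v(1,2)]
    have "v 0 \<noteq> 0" using eq[of x] x by auto
    then have "sol \<mu> L = 0" using eq[of L] v(3) L_pos by auto
    then have "\<mu> \<notin> shoot_positive" using L_pos by (force simp: shoot_positive_def)
    then show "E \<le> \<mu>" using below[of \<mu>] by force
  qed
  then show ?thesis
    using that[of "sol E" "sol' E"] shoot_pair[of E] sol_0 at_end interior by auto
qed

end

section \<open>The landscape function\<close>

lemma C1_pair_cong_fun:
  assumes uv: "C1_pair S a b u v h" and eq: "\<And>x. x \<in> {a..b} \<Longrightarrow> u x = w x"
  shows "C1_pair S a b w v h"
  unfolding C1_pair_def
proof (intro conjI ballI)
  note c = C1_pairD[OF uv]
  show "continuous_on {a..b} w" using c(1) by (rule continuous_on_eq) (rule eq)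
  show "continuous_on {a..b} v" by (rule c)
  fix x assume x: "x \<in> {a<..<b}"
  show "(w has_real_derivative v x) (at x)"
    by (rule has_field_derivative_transform_within_open[OF c(3)[OF x], of "{a<..<b}"])
       (use x eq in auto)
qed (use C1_pairD(4)[OF uv] in auto)

text \<open>
  The bound \<open>d(x)\<^sup>2 \<le> x \<integral>\<^sub>0\<^sup>x d'\<^sup>2\<close>, from expanding the square of \<open>d' - d(x) / x\<close> and integrating.
  It turns the energy estimates below into estimates in the maximum norm.
\<close>
lemma square_le_integral_derivative:
  fixes d d' :: "real \<Rightarrow> real"
  assumes d: "continuous_on {0..L} d" "continuous_on {0..L} d'"
      "\<And>x. x \<in> {0<..<L} \<Longrightarrow> (d has_real_derivative d' x) (at x)" "d 0 = 0"
    and x: "x \<in> {0..L}"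
  shows "(d x)\<^sup>2 \<le> L * integral {0..L} (\<lambda>x. (d' x)\<^sup>2)"
proof -
  have sub: "{0..x} \<subseteq> {0..L}" using x by auto
  have int: "(\<lambda>x. (d' x)\<^sup>2) integrable_on {0..L}" "(\<lambda>x. (d' x)\<^sup>2) integrable_on {0..x}"
    by (intro integrable_continuous_real continuous_intros d continuous_on_subset[OF d(2) sub])+
  have I: "0 \<le> integral {0..L} (\<lambda>x. (d' x)\<^sup>2)" by (intro integral_nonneg int) auto
  show ?thesis
  proof (cases "x = 0")
    case True
    then show ?thesis using d(4) I x by auto
  next
    case False
    then have xp: "0 < x" using x by auto
    define c where "c = d x / x"
    have "((\<lambda>r. d' r) has_integral (d x - d 0)) {0..x}"
      by (rule has_integral_derivative[where S = "{}"])
         (use x d in \<open>auto intro: continuous_on_subset[OF d(1) sub]\<close>)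
    then have "((\<lambda>r. 2 * c * d' r - c\<^sup>2) has_integral (2 * c * (d x - d 0) - c\<^sup>2 * (x - 0))) {0..x}"
      using has_integral_const_real[of "c\<^sup>2" 0 x] xp
      by (intro has_integral_diff has_integral_mult_right) (auto simp: mult.commute)
    then have "2 * c * (d x - d 0) - c\<^sup>2 * (x - 0) \<le> integral {0..x} (\<lambda>x. (d' x)\<^sup>2)"
    proof (rule has_integral_le[OF _ integrable_integral[OF int(2)]])
      fix r
      have "0 \<le> (d' r - c)\<^sup>2" by simp
      then show "2 * c * d' r - c\<^sup>2 \<le> (d' r)\<^sup>2" by (simp add: power2_eq_square algebra_simps)
    qed
    also have "\<dots> \<le> integral {0..L} (\<lambda>x. (d' x)\<^sup>2)"
      by (rule integral_subset_le[OF sub int(2,1)]) auto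
    also have "2 * c * (d x - d 0) - c\<^sup>2 * (x - 0) = (d x)\<^sup>2 / x"
      using xp d(4) by (simp add: c_def power2_eq_square field_simps)
    finally have "(d x)\<^sup>2 \<le> x * integral {0..L} (\<lambda>x. (d' x)\<^sup>2)"
      using xp by (simp add: field_simps)
    also have "\<dots> \<le> L * integral {0..L} (\<lambda>x. (d' x)\<^sup>2)"
      using x I by (intro mult_right_mono) auto
    finally show ?thesis .
  qed
qed

text \<open>
  Testing \<open>- U'' + a U = 1\<close> with \<open>U\<close> gives \<open>\<integral> (U'\<^sup>2 + a U\<^sup>2) = \<integral> U\<close>.
\<close>
lemma constant_landscape_energy:
  fixes U U' :: "real \<Rightarrow> real"
  assumes L: "0 < L" and a: "0 \<le> a"
    and U: "C1_pair {} 0 L U U' (\<lambda>x. a * U x - 1)" "U 0 = 0" "U L = 0"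
    and M: "\<And>x. x \<in> {0..L} \<Longrightarrow> \<bar>U x\<bar> \<le> M"
  shows "integral {0..L} (\<lambda>x. (U' x)\<^sup>2) \<le> M * L"
proof -
  note C = C1_pairD[OF U(1)]
  define J where "J = integral {0..L} (\<lambda>x. (U' x)\<^sup>2)"
  have J_int: "((\<lambda>x. (U' x)\<^sup>2) has_integral J) {0..L}"
    unfolding J_def by (intro integrable_integral integrable_continuous_real continuous_intros C)
  have "((\<lambda>x. (U' x)\<^sup>2 + a * (U x)\<^sup>2 - U x) has_integral (U L * U' L - U 0 * U' 0)) {0..L}"
  proof (rule has_integral_derivative[where S = "{}"])
    show "continuous_on {0..L} (\<lambda>x. U x * U' x)" by (intro continuous_intros C)
    fix x assume x: "x \<in> {0<..<L} - {}"
    show "((\<lambda>x. U x * U' x) has_real_derivative (U' x)\<^sup>2 + a * (U x)\<^sup>2 - U x) (at x)"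
      using C(3)[of x] C(4)[OF x] x
      by (auto intro!: derivative_eq_intros simp: power2_eq_square algebra_simps)
  qed (use L in auto)
  then have zero: "((\<lambda>x. (U' x)\<^sup>2 + a * (U x)\<^sup>2 - U x) has_integral 0) {0..L}" by (simp add: U)
  have "((\<lambda>x. (U' x)\<^sup>2 - M) has_integral J - M * L) {0..L}"
    using has_integral_const_real[of M 0 L] L
    by (intro has_integral_diff J_int) (auto simp: mult.commute)
  then have "J - M * L \<le> 0"
  proof (rule has_integral_le[OF _ zero])
    fix x assume "x \<in> {0..L}"
    then have "U x \<le> M" using M[of x] by (simp add: abs_le_iff)
    moreover have "0 \<le> a * (U x)\<^sup>2" using a by simp
    ultimately show "(U' x)\<^sup>2 - M \<le> (U' x)\<^sup>2 + a * (U x)\<^sup>2 - U x" by linarith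
  qed
  then show ?thesis by (simp add: J_def)
qed

context potential begin

text \<open>
  Existence: any particular solution vanishing at \<open>0\<close> is corrected by a multiple of the shooting
  function for \<open>\<mu> = 0\<close>, which is positive at \<open>L\<close>. Uniqueness: a difference of two solutions is a
  multiple of this shooting function that vanishes at \<open>L\<close>.
\<close>
lemma landscape_pair:
  obtains v where "C1_pair S 0 L (landscape W L) v (\<lambda>x. W x * landscape W L x - 1)"
    "landscape W L 0 = 0" "landscape W L L = 0"
proof -
  define P where "P u \<longleftrightarrow> dirichlet_schroedinger W L u (\<lambda>x. 1) \<and> (\<forall>x. x \<notin> {0..L} \<longrightarrow> u x = 0)" for u
  have pos: "0 < sol 0 L" using nonpos_in_shoot_positive[of 0] L_pos by (auto simp: shoot_positive_def)
  have "\<exists>!u. P u"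
  proof (rule ex_ex1I)
    obtain p w where pw: "C1_pair S 0 L p w (\<lambda>x. (W x - 0) * p x + (- 1))" "p 0 = 0" "w 0 = 0"
      by (rule ivp_solution)
    define c where "c = - p L / sol 0 L"
    define u0 where "u0 x = 1 * p x + c * sol 0 x" for x
    define u where "u x = (if x \<in> {0..L} then u0 x else 0)" for x
    have "C1_pair S 0 L u0 (\<lambda>x. 1 * w x + c * sol' 0 x) (\<lambda>x. (W x - 0) * u0 x - 1)"
      unfolding u0_def[abs_def]
      by (rule C1_pair_linear[OF pw(1) shoot_pair]) (simp add: algebra_simps)
    then have "C1_pair S 0 L u (\<lambda>x. 1 * w x + c * sol' 0 x) (\<lambda>x. (W x - 0) * u0 x - 1)"
      by (rule C1_pair_cong_fun) (simp add: u_def)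
    then have "C1_pair S 0 L u (\<lambda>x. 1 * w x + c * sol' 0 x) (\<lambda>x. (W x - 0) * u x - 1)"
      by (rule C1_pair_cong) (simp add: u_def)
    then have "dirichlet_schroedinger W L u (\<lambda>x. 1)"
      by (rule C1_pair_imp_dirichlet) (use pos L_pos pw(2) in \<open>auto simp: u_def u0_def c_def sol_0\<close>)
    then show "\<exists>u. P u" by (intro exI[of _ u]) (auto simp: P_def u_def)
  next
    fix u1 u2 assume P: "P u1" "P u2"
    obtain v1 where v1: "C1_pair S 0 L u1 v1 (\<lambda>x. (W x - 0) * u1 x - 1)" "u1 0 = 0" "u1 L = 0"
      using P dirichlet_imp_C1_pair[of u1 "\<lambda>x. 1" 0 1] unfolding P_def by auto
    obtain v2 where v2: "C1_pair S 0 L u2 v2 (\<lambda>x. (W x - 0) * u2 x - 1)" "u2 0 = 0" "u2 L = 0"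
      using P dirichlet_imp_C1_pair[of u2 "\<lambda>x. 1" 0 1] unfolding P_def by auto
    have "C1_pair S 0 L (\<lambda>x. 1 * u1 x + (-1) * u2 x) (\<lambda>x. 1 * v1 x + (-1) * v2 x)
        (\<lambda>x. (W x - 0) * (1 * u1 x + (-1) * u2 x))"
      by (rule C1_pair_linear[OF v1(1) v2(1)]) (simp add: algebra_simps)
    from ivp_eq_shoot[OF this] have d: "u1 x - u2 x = (v1 0 - v2 0) * sol 0 x" if "x \<in> {0..L}" for x
      using that v1(2) v2(2) by simp
    have "v1 0 - v2 0 = 0" using d[of L] pos v1(3) v2(3) L_pos by auto
    then have "u1 x = u2 x" for x
      using d[of x] P by (cases "x \<in> {0..L}") (auto simp: P_def)
    then show "u1 = u2" by blast
  qed
  then have "P (landscape W L)" unfolding landscape_def P_def by (rule theI')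
  then have "dirichlet_schroedinger W L (landscape W L) (\<lambda>x. 1)" by (simp add: P_def)
  then show ?thesis
    using dirichlet_imp_C1_pair[of "landscape W L" "\<lambda>x. 1" 0 1] that by auto
qed

text \<open>
  Maximum principle. At an interior minimum \<open>z\<close> with value at most \<open>0\<close> the derivative \<open>v\<close> vanishes,
  while \<open>u'' = W u - 1\<close> stays below \<open>-1/2\<close> nearby by continuity of \<open>u\<close>. So \<open>u\<close> would decrease to the
  right of \<open>z\<close>.
\<close>
lemma landscape_pos:
  assumes x: "x \<in> {0<..<L}"
  shows "0 < landscape W L x"
proof (rule ccontr)
  define u where "u = landscape W L"
  obtain v where uv: "C1_pair S 0 L u v (\<lambda>x. W x * u x - 1)" and u0: "u 0 = 0" "u L = 0"
    unfolding u_def by (rule landscape_pair)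
  note c = C1_pairD[OF uv]
  assume "\<not> 0 < landscape W L x"
  then have ux: "u x \<le> 0" by (simp add: u_def)
  obtain x0 where x0: "x0 \<in> {0..L}" "\<And>r. r \<in> {0..L} \<Longrightarrow> u x0 \<le> u r"
    using continuous_attains_inf[of "{0..L}" u] c(1) L_pos by auto
  obtain z where z: "z \<in> {0<..<L}" "u z \<le> 0" "\<And>r. r \<in> {0..L} \<Longrightarrow> u z \<le> u r"
  proof (cases "x0 \<in> {0<..<L}")
    case True
    moreover have "u x0 \<le> u x" using x by (intro x0(2)) auto
    ultimately show ?thesis using that[of x0] x0 ux by auto
  next
    case False
    then have "u x0 = 0" using x0(1) u0 by (auto simp: le_less)
    then show ?thesis using that[of x] x ux x0(2) by (force intro: order_trans)
  qed
  have vz: "v z = 0"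
  proof (rule DERIV_local_min)
    show "(u has_real_derivative v z) (at z)" by (rule c(3)[OF z(1)])
    show "0 < min z (L - z)" using z by auto
    show "\<forall>r. \<bar>z - r\<bar> < min z (L - z) \<longrightarrow> u z \<le> u r"
      using z(3) by (auto simp: abs_less_iff)
  qed
  have eps: "0 < 1 / (2 * (B + 1))" using B_nonneg by auto
  have zL: "z \<in> {0..L}" using z(1) by auto
  obtain r where r: "r > 0" "\<And>t. t \<in> {0..L} \<Longrightarrow> dist t z < r \<Longrightarrow> dist (u t) (u z) < 1 / (2 * (B + 1))"
    using c(1)[unfolded continuous_on_iff, rule_format, OF zL eps] by blast
  define e where "e = min (r/2) ((L - z)/2)"
  have e: "0 < e" "z + e < L" "e < r" using r z by (auto simp: e_def min_def field_simps)
  have force: "W t * u t - 1 \<le> - (1/2)" if t: "t \<in> {z..z + e}" for t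
  proof -
    have tL: "t \<in> {0..L}" using t z e by auto
    have "dist (u t) (u z) < 1 / (2 * (B + 1))" using t e by (intro r tL) (auto simp: dist_real_def)
    then have "u t \<le> 1 / (2 * (B + 1))" using z(2) by (simp add: dist_real_def abs_less_iff)
    then have "W t * u t \<le> W t * (1 / (2 * (B + 1)))" by (intro mult_left_mono W_nonneg)
    also have "\<dots> \<le> B * (1 / (2 * (B + 1)))" using B_nonneg by (intro mult_right_mono W_le) auto
    also have "\<dots> \<le> 1/2" using B_nonneg by (simp add: field_simps)
    finally show ?thesis by simp
  qed
  have v_neg: "v t < 0" if t: "t \<in> {z<..z + e}" for t
  proof -
    note ct = C1_pairD[OF C1_pair_subinterval[OF uv, of z t]]
    have "v t - v z \<le> - (1/2) * (t - z)"
    proof (rule increment_le[OF fin])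
      show "continuous_on {z..t} v" by (rule ct) (use t z e in auto)
      fix s assume s: "s \<in> {z<..<t} - S"
      show "(v has_real_derivative W s * u s - 1) (at s)" by (rule ct) (use s t z e in auto)
      show "W s * u s - 1 \<le> - (1/2)" by (rule force) (use s t in auto)
    qed (use t in auto)
    moreover have "0 < 1/2 * (t - z)" using t by simp
    ultimately show ?thesis using vz by linarith
  qed
  have c2: "continuous_on {z..z + e} u"
    by (rule continuous_on_subset[OF c(1)]) (use z e in auto)
  have "u (z + e) < u z"
  proof (rule DERIV_neg_imp_decreasing_open[of z "z + e" u])
    fix t assume "z < t" "t < z + e"
    then show "\<exists>y. (u has_real_derivative y) (at t) \<and> y < 0"
      using c(3)[of t] v_neg[of t] z e by auto
  qed (use c2 e in auto)
  moreover have "u z \<le> u (z + e)" by (rule z(3)) (use z e in auto)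
  ultimately show False by simp
qed

end

section \<open>Potentials close to a constant in the mean\<close>

text \<open>
  The smallness of the primitive \<open>Q\<close> measures closeness to the constant \<open>a\<close>; \<open>W - a\<close> itself need
  not be small anywhere. The factor \<open>1 / L\<close> makes \<open>\<eta>\<close> invariant under rescaling the interval, since
  \<open>W\<close> scales like \<open>1 / L\<^sup>2\<close>.
\<close>
locale averaged_potential = potential +
  fixes a \<eta> :: real and Q :: "real \<Rightarrow> real"
  assumes a_nonneg: "0 \<le> a" and \<eta>_nonneg: "0 \<le> \<eta>" and \<eta>_le: "\<eta> \<le> 1/8"
    and Q_cont: "continuous_on {0..L} Q"
    and Q_deriv: "x \<in> {0<..<L} - S \<Longrightarrow> (Q has_real_derivative W x - a) (at x)"
    and Q_le: "x \<in> {0..L} \<Longrightarrow> \<bar>Q x\<bar> \<le> \<eta> / L"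
begin

definition "A = (pi / L)\<^sup>2 + a"

lemma A_pos: "0 < A" using L_pos a_nonneg by (auto simp: A_def intro!: add_pos_nonneg)

lemma inverse_L_le: "1 / L\<^sup>2 \<le> (pi / L)\<^sup>2"
proof -
  have "1 \<le> pi\<^sup>2" using pi_gt3 by (intro one_le_power) auto
  then show ?thesis using L_pos by (simp add: power_divide divide_right_mono)
qed

text \<open>
  The form in which \<open>Q\<close> is small: after integration, and with Poincare's inequality, such cross terms
  are absorbed into the Dirichlet energy.
\<close>
lemma Q_cross_le:
  assumes "x \<in> {0..L}"
  shows "2 * Q x * s * t \<le> \<eta> * (s\<^sup>2 / L\<^sup>2 + t\<^sup>2)"
proof -
  have "2 * Q x * s * t \<le> \<bar>Q x\<bar> * (2 * \<bar>s\<bar> * \<bar>t\<bar>)"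
    by (rule order_trans[OF abs_ge_self]) (simp add: abs_mult)
  also have "\<dots> \<le> \<eta> / L * (2 * \<bar>s\<bar> * \<bar>t\<bar>)" by (rule mult_right_mono[OF Q_le[OF assms]]) simp
  also have "\<dots> = \<eta> * (2 * (\<bar>s\<bar> / L) * \<bar>t\<bar>)" by simp
  also have "\<dots> \<le> \<eta> * ((\<bar>s\<bar> / L)\<^sup>2 + \<bar>t\<bar>\<^sup>2)"
    by (rule mult_left_mono[OF sum_squares_bound \<eta>_nonneg])
  finally show ?thesis by (simp add: power_divide)
qed

text \<open>
  The ground state is positive on \<open>[\<delta>, L - \<delta>]\<close>, so the half sine wave of this interval is an
  admissible test function; then \<open>\<delta>\<close> tends to \<open>0\<close>.
\<close>
lemma ground_state_eigenvalue_upper: "ground_state_eigenvalue W L \<le> (1 + 2 * \<eta>) * A"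
proof -
  let ?E = "ground_state_eigenvalue W L"
  obtain \<phi> \<phi>' where \<phi>: "C1_pair S 0 L \<phi> \<phi>' (\<lambda>x. (W x - ?E) * \<phi> x)"
    "\<And>x. x \<in> {0<..<L} \<Longrightarrow> 0 < \<phi> x"
    using ground_state by blast
  have "?E \<le> (1 + \<eta>) * (pi / (L - \<delta> - \<delta>))\<^sup>2 + a + \<eta> / L\<^sup>2" if "\<delta> \<in> {0<..<L/2}" for \<delta>
    by (rule eigenvalue_le_of_positive[OF C1_pair_subinterval[OF \<phi>(1)] _ _ _ _ Q_cont Q_deriv Q_le])
       (use that \<phi>(2) in auto)
  then have "\<forall>\<^sub>F \<delta> in at_right 0. ?E \<le> (1 + \<eta>) * (pi / (L - \<delta> - \<delta>))\<^sup>2 + a + \<eta> / L\<^sup>2"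
    using eventually_at_right_real[of 0 "L/2"] L_pos by (auto elim: eventually_mono)
  moreover have "((\<lambda>\<delta>. (1 + \<eta>) * (pi / (L - \<delta> - \<delta>))\<^sup>2 + a + \<eta> / L\<^sup>2) \<longlongrightarrow>
      (1 + \<eta>) * (pi / (L - 0 - 0))\<^sup>2 + a + \<eta> / L\<^sup>2) (at_right 0)"
    by (intro tendsto_intros) (use L_pos in auto)
  ultimately have "?E \<le> (1 + \<eta>) * (pi / L)\<^sup>2 + a + \<eta> * (1 / L\<^sup>2)"
    using tendsto_lowerbound[OF _ _ trivial_limit_at_right_real] by fastforce
  also have "\<dots> \<le> (1 + \<eta>) * (pi / L)\<^sup>2 + a + \<eta> * (pi / L)\<^sup>2"
    by (intro add_left_mono mult_left_mono inverse_L_le \<eta>_nonneg)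
  also have "\<dots> \<le> (1 + 2 * \<eta>) * A"
    using \<eta>_nonneg a_nonneg by (simp add: A_def algebra_simps)
  finally show ?thesis .
qed

text \<open>
  The energy identity of the ground state \<open>\<phi>\<close>, obtained by integrating the derivative of
  \<open>\<phi> \<phi>' - Q \<phi>\<^sup>2\<close>, combined with Poincare's inequality for \<open>\<phi>\<close>.
\<close>
lemma ground_state_eigenvalue_lower: "(1 - 2 * \<eta>) * A \<le> ground_state_eigenvalue W L"
proof -
  let ?E = "ground_state_eigenvalue W L"
  obtain \<phi> \<phi>' where \<phi>: "C1_pair S 0 L \<phi> \<phi>' (\<lambda>x. (W x - ?E) * \<phi> x)" "\<phi> 0 = 0" "\<phi> L = 0"
    and pos: "\<And>x. x \<in> {0<..<L} \<Longrightarrow> 0 < \<phi> x"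
    using ground_state by blast
  note p = C1_pairD[OF \<phi>(1)]
  define I0 I1 where "I0 = integral {0..L} (\<lambda>x. (\<phi> x)\<^sup>2)" and "I1 = integral {0..L} (\<lambda>x. (\<phi>' x)\<^sup>2)"
  have int: "((\<lambda>x. (\<phi> x)\<^sup>2) has_integral I0) {0..L}" "((\<lambda>x. (\<phi>' x)\<^sup>2) has_integral I1) {0..L}"
    unfolding I0_def I1_def
    by (intro integrable_integral integrable_continuous_real continuous_intros p)+
  have poinc: "(pi / L)\<^sup>2 * I0 \<le> I1"
    unfolding I0_def I1_def by (rule poincare_inequality[OF L_pos p(1,2,3) \<phi>(2,3)])
  have "0 \<le> I0" by (rule has_integral_nonneg[OF int(1)]) simp
  moreover have "I0 \<noteq> 0"
  proof
    assume "I0 = 0"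
    moreover have "continuous_on {0..L} (\<lambda>x. (\<phi> x)\<^sup>2)" by (intro continuous_intros p)
    ultimately have "\<phi> (L/2) = 0"
      using integral_eq_0_iff[of 0 L "\<lambda>x. (\<phi> x)\<^sup>2"] L_pos by (auto simp: I0_def)
    then show False using pos[of "L/2"] L_pos by auto
  qed
  ultimately have I0: "0 < I0" by simp
  define F where "F x = \<phi> x * \<phi>' x - Q x * (\<phi> x)\<^sup>2" for x
  have "((\<lambda>x. (\<phi>' x)\<^sup>2 + (a - ?E) * (\<phi> x)\<^sup>2 - 2 * Q x * \<phi> x * \<phi>' x) has_integral (F L - F 0)) {0..L}"
  proof (rule has_integral_derivative[OF fin])
    show "continuous_on {0..L} F" unfolding F_def by (intro continuous_intros p Q_cont)
    fix x assume x: "x \<in> {0<..<L} - S"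
    show "(F has_real_derivative (\<phi>' x)\<^sup>2 + (a - ?E) * (\<phi> x)\<^sup>2 - 2 * Q x * \<phi> x * \<phi>' x) (at x)"
      unfolding F_def using p(3)[of x] p(4)[OF x] Q_deriv[OF x] x
      by (auto intro!: derivative_eq_intros simp: power2_eq_square algebra_simps)
  qed (use L_pos in auto)
  moreover have "F L - F 0 = 0" by (simp add: F_def \<phi>)
  ultimately have zero: "((\<lambda>x. (\<phi>' x)\<^sup>2 + (a - ?E) * (\<phi> x)\<^sup>2 - 2 * Q x * \<phi> x * \<phi>' x) has_integral 0) {0..L}"
    by simp
  have "((\<lambda>x. (1 - \<eta>) * (\<phi>' x)\<^sup>2 + (a - ?E - \<eta> / L\<^sup>2) * (\<phi> x)\<^sup>2) has_integral
      (1 - \<eta>) * I1 + (a - ?E - \<eta> / L\<^sup>2) * I0) {0..L}"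
    by (intro has_integral_add has_integral_mult_right int)
  then have "(1 - \<eta>) * I1 + (a - ?E - \<eta> / L\<^sup>2) * I0 \<le> 0"
  proof (rule has_integral_le[OF _ zero])
    fix x assume "x \<in> {0..L}"
    from Q_cross_le[OF this, of "\<phi> x" "\<phi>' x"]
    show "(1 - \<eta>) * (\<phi>' x)\<^sup>2 + (a - ?E - \<eta> / L\<^sup>2) * (\<phi> x)\<^sup>2
        \<le> (\<phi>' x)\<^sup>2 + (a - ?E) * (\<phi> x)\<^sup>2 - 2 * Q x * \<phi> x * \<phi>' x"
      by (simp add: algebra_simps)
  qed
  moreover have "(1 - \<eta>) * ((pi / L)\<^sup>2 * I0) \<le> (1 - \<eta>) * I1"
    using \<eta>_le by (intro mult_left_mono poinc) auto
  moreover have "\<eta> / L\<^sup>2 * I0 \<le> \<eta> * (pi / L)\<^sup>2 * I0"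
    using mult_left_mono[OF inverse_L_le \<eta>_nonneg] I0 by (intro mult_right_mono) auto
  ultimately have "((1 - 2 * \<eta>) * (pi / L)\<^sup>2 + a) * I0 \<le> ?E * I0"
    by (simp add: algebra_simps)
  then have "(1 - 2 * \<eta>) * (pi / L)\<^sup>2 + a \<le> ?E" using I0 by simp
  moreover have "(1 - 2 * \<eta>) * A \<le> (1 - 2 * \<eta>) * (pi / L)\<^sup>2 + a"
    using \<eta>_nonneg a_nonneg by (simp add: A_def algebra_simps)
  ultimately show ?thesis by linarith
qed

text \<open>
  The difference \<open>d\<close> of the landscape functions for \<open>W\<close> and for \<open>a\<close> satisfies
  \<open>d'' = W d + (W - a) U\<close>. Integrating the derivative of \<open>d d' - Q d\<^sup>2 - Q U d\<close> removes \<open>W\<close>: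
  the energy \<open>\<integral> (d'\<^sup>2 + a d\<^sup>2)\<close> equals a sum of integrals in which \<open>Q\<close> multiplies products of
  \<open>U\<close>, \<open>U'\<close>, \<open>d\<close>, \<open>d'\<close>. By Young's inequality the parts containing \<open>d\<close> are absorbed on the left,
  and the rest is of order \<open>\<eta>\<^sup>2 (M\<^sup>2 / L + M / (L A))\<close>.
\<close>
lemma landscape_comparison:
  assumes U: "C1_pair {} 0 L U U' (\<lambda>x. a * U x - 1)" "U 0 = 0" "U L = 0"
    and M: "\<And>x. x \<in> {0..L} \<Longrightarrow> \<bar>U x\<bar> \<le> M" and x: "x \<in> {0..L}"
  shows "(landscape W L x - U x)\<^sup>2 \<le> 4 * \<eta>\<^sup>2 * (M\<^sup>2 + M / A)"
proof -
  define u where "u = landscape W L"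
  obtain v where uv: "C1_pair S 0 L u v (\<lambda>x. W x * u x - 1)" and u0: "u 0 = 0" "u L = 0"
    unfolding u_def by (rule landscape_pair)
  note c = C1_pairD[OF uv] and C = C1_pairD[OF U(1)]
  have US: "C1_pair S 0 L U U' (\<lambda>x. a * U x - 1)" using U(1) by (auto simp: C1_pair_def)
  define d d' where "d x = u x - U x" and "d' x = v x - U' x" for x
  have d: "C1_pair S 0 L d d' (\<lambda>x. W x * d x + (W x - a) * U x)"
    using C1_pair_linear[OF uv US, of "\<lambda>x. W x * d x + (W x - a) * U x" 1 "-1"]
    by (simp add: d_def[abs_def] d'_def[abs_def] algebra_simps)
  note p = C1_pairD[OF d]
  have d0: "d 0 = 0" "d L = 0" using U u0 by (auto simp: d_def)
  have M0: "0 \<le> M" using order_trans[OF abs_ge_zero M[of 0]] L_pos by auto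
  define J where "J = integral {0..L} (\<lambda>x. (U' x)\<^sup>2)"
  have J_int: "((\<lambda>x. (U' x)\<^sup>2) has_integral J) {0..L}"
    unfolding J_def by (intro integrable_integral integrable_continuous_real continuous_intros C)
  have J_le: "J \<le> M * L"
    unfolding J_def by (rule constant_landscape_energy[OF L_pos a_nonneg U M])
  define I0 I1 where "I0 = integral {0..L} (\<lambda>x. (d x)\<^sup>2)" and "I1 = integral {0..L} (\<lambda>x. (d' x)\<^sup>2)"
  have int: "((\<lambda>x. (d x)\<^sup>2) has_integral I0) {0..L}" "((\<lambda>x. (d' x)\<^sup>2) has_integral I1) {0..L}"
    unfolding I0_def I1_def
    by (intro integrable_integral integrable_continuous_real continuous_intros p)+
  have poinc: "(pi / L)\<^sup>2 * I0 \<le> I1"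
    unfolding I0_def I1_def by (rule poincare_inequality[OF L_pos p(1,2,3) d0])
  have I0: "0 \<le> I0" by (rule has_integral_nonneg[OF int(1)]) simp
  have I1: "0 \<le> I1" by (rule has_integral_nonneg[OF int(2)]) simp
  define F where "F x = d x * d' x - Q x * (d x)\<^sup>2 - Q x * U x * d x" for x
  define G where "G x = (d' x)\<^sup>2 + a * (d x)\<^sup>2 - 2 * Q x * d x * d' x - Q x * U' x * d x - Q x * U x * d' x" for x
  have "(G has_integral (F L - F 0)) {0..L}"
  proof (rule has_integral_derivative[OF fin])
    show "continuous_on {0..L} F" unfolding F_def by (intro continuous_intros p C Q_cont)
    fix x assume x: "x \<in> {0<..<L} - S"
    show "(F has_real_derivative G x) (at x)"
      unfolding F_def G_def using p(3)[of x] p(4)[OF x] Q_deriv[OF x] C(3)[of x] x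
      by (auto intro!: derivative_eq_intros simp: power2_eq_square algebra_simps)
  qed (use L_pos in auto)
  moreover have "F L - F 0 = 0" by (simp add: F_def d0)
  ultimately have zero: "(G has_integral 0) {0..L}" by simp
  define k where "k = 2 * \<eta>\<^sup>2 / (L\<^sup>2 * A)"
  have "((\<lambda>x. (7/8 - \<eta>) * (d' x)\<^sup>2 + (a - \<eta> / L\<^sup>2 - A / 8) * (d x)\<^sup>2 - k * (U' x)\<^sup>2 - 2 * \<eta>\<^sup>2 * M\<^sup>2 / L\<^sup>2)
     has_integral ((7/8 - \<eta>) * I1 + (a - \<eta> / L\<^sup>2 - A / 8) * I0 - k * J - 2 * \<eta>\<^sup>2 * M\<^sup>2 / L\<^sup>2 * L)) {0..L}"
    using has_integral_const_real[of "2 * \<eta>\<^sup>2 * M\<^sup>2 / L\<^sup>2" 0 L] L_pos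
    by (intro has_integral_add has_integral_diff has_integral_mult_right int J_int) (auto simp: mult.commute)
  then have "(7/8 - \<eta>) * I1 + (a - \<eta> / L\<^sup>2 - A / 8) * I0 - k * J - 2 * \<eta>\<^sup>2 * M\<^sup>2 / L\<^sup>2 * L \<le> 0"
  proof (rule has_integral_le[OF _ zero])
    fix x assume x: "x \<in> {0..L}"
    \<comment> \<open>the fractions of \<open>d'\<^sup>2\<close> and \<open>A d\<^sup>2\<close> given away here and in \<open>Q_cross_le\<close> leave half of the energy\<close>
    have young: "p * q \<le> e * q\<^sup>2 / 8 + 2 * p\<^sup>2 / e" if "0 < e" for p q e :: real
    proof -
      have "0 \<le> (e * q - 4 * p)\<^sup>2 / (8 * e)" using that by simp
      also have "\<dots> = e * q\<^sup>2 / 8 + 2 * p\<^sup>2 / e - p * q"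
        using that by (simp add: power2_eq_square field_simps)
      finally show ?thesis by simp
    qed
    have QL: "(Q x)\<^sup>2 \<le> \<eta>\<^sup>2 / L\<^sup>2"
      using power_mono[OF Q_le[OF x], of 2] by (simp add: power_divide)
    have "Q x * U x * d' x \<le> 1 * (d' x)\<^sup>2 / 8 + 2 * (Q x * U x)\<^sup>2 / 1" by (rule young) simp
    moreover have "(Q x * U x)\<^sup>2 \<le> \<eta>\<^sup>2 / L\<^sup>2 * M\<^sup>2"
      unfolding power_mult_distrib using power_mono[OF M[OF x], of 2]
      by (intro mult_mono QL) auto
    moreover have "Q x * U' x * d x \<le> A * (d x)\<^sup>2 / 8 + 2 * (Q x * U' x)\<^sup>2 / A" by (rule young[OF A_pos])
    moreover have "2 * (Q x * U' x)\<^sup>2 / A \<le> k * (U' x)\<^sup>2"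
    proof -
      have "(Q x)\<^sup>2 * (2 * (U' x)\<^sup>2 / A) \<le> \<eta>\<^sup>2 / L\<^sup>2 * (2 * (U' x)\<^sup>2 / A)"
        using A_pos by (intro mult_right_mono QL) auto
      then show ?thesis by (simp add: k_def power_mult_distrib mult_ac)
    qed
    ultimately show "(7/8 - \<eta>) * (d' x)\<^sup>2 + (a - \<eta> / L\<^sup>2 - A / 8) * (d x)\<^sup>2 - k * (U' x)\<^sup>2 - 2 * \<eta>\<^sup>2 * M\<^sup>2 / L\<^sup>2 \<le> G x"
      using Q_cross_le[OF x, of "d x" "d' x"] unfolding G_def by (simp add: algebra_simps)
  qed
  moreover have "\<eta> / L\<^sup>2 * I0 \<le> \<eta> * I1"
  proof -
    have "1 / L\<^sup>2 * I0 \<le> (pi / L)\<^sup>2 * I0" by (intro mult_right_mono inverse_L_le I0)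
    then have "1 / L\<^sup>2 * I0 \<le> I1" using poinc by linarith
    from mult_left_mono[OF this \<eta>_nonneg] show ?thesis by simp
  qed
  moreover have "A * I0 \<le> I1 + a * I0" using poinc by (simp add: A_def algebra_simps)
  moreover have "0 \<le> a * I0" using a_nonneg I0 by simp
  moreover have "2 * \<eta> * I1 \<le> 2 * (1/8) * I1" using \<eta>_le I1 by (intro mult_right_mono) auto
  moreover have "k * J \<le> k * (M * L)"
    using A_pos by (intro mult_left_mono J_le) (auto simp: k_def)
  ultimately have "I1 / 2 \<le> k * (M * L) + 2 * \<eta>\<^sup>2 * M\<^sup>2 / L\<^sup>2 * L"
    by (simp add: algebra_simps)
  then have "L * I1 \<le> 2 * L * (k * (M * L) + 2 * \<eta>\<^sup>2 * M\<^sup>2 / L\<^sup>2 * L)"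
    using L_pos by simp
  also have "\<dots> = 4 * \<eta>\<^sup>2 * (M\<^sup>2 + M / A)"
    using L_pos A_pos by (simp add: k_def field_simps power2_eq_square)
  finally have "L * I1 \<le> 4 * \<eta>\<^sup>2 * (M\<^sup>2 + M / A)" .
  moreover have "(d x)\<^sup>2 \<le> L * I1"
    unfolding I1_def by (rule square_le_integral_derivative[OF p(1,2,3) d0(1) x])
  ultimately show ?thesis by (simp add: d_def u_def)
qed

end

section \<open>The constant potential\<close>

text \<open>
  The maximum of the landscape function of the constant potential \<open>t\<close> on the unit interval; the
  value at \<open>0\<close> is the limit of the formula for \<open>t > 0\<close>.
\<close>
definition const_landscape_max :: "real \<Rightarrow> real" where
  "const_landscape_max t = (if t = 0 then 1/8 else (1 - 1 / cosh (sqrt t / 2)) / t)"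

definition const_ratio :: "real \<Rightarrow> real" where
  "const_ratio t = (pi\<^sup>2 + t) * const_landscape_max t"

lemma const_landscape:
  fixes L a :: real
  assumes L: "0 < L" and a: "0 \<le> a"
  defines "M \<equiv> L\<^sup>2 * const_landscape_max (a * L\<^sup>2)"
  obtains U U' where "C1_pair {} 0 L U U' (\<lambda>x. a * U x - 1)" "U 0 = 0" "U L = 0"
    "\<And>x. x \<in> {0..L} \<Longrightarrow> 0 \<le> U x \<and> U x \<le> M" "U (L/2) = M"
proof (cases "a = 0")
  case True
  define U where "U x = x * (L - x) / 2" for x
  show ?thesis
  proof (rule that[of U "\<lambda>x. (L - 2 * x) / 2"])
    show "C1_pair {} 0 L U (\<lambda>x. (L - 2 * x) / 2) (\<lambda>x. a * U x - 1)"
      unfolding C1_pair_def U_def True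
      by (auto intro!: continuous_intros derivative_eq_intros simp: field_simps)
    show "U (L/2) = M" by (simp add: U_def M_def True const_landscape_max_def power2_eq_square)
    fix x assume x: "x \<in> {0..L}"
    have "M - U x = (L - 2 * x)\<^sup>2 / 8"
      by (simp add: U_def M_def True const_landscape_max_def power2_eq_square field_simps)
    then have "U x \<le> M" using zero_le_power2[of "L - 2 * x"] by linarith
    then show "0 \<le> U x \<and> U x \<le> M" using x by (simp add: U_def)
  qed (auto simp: U_def)
next
  case False
  then have a0: "0 < a" using a by simp
  define w where "w = sqrt a"
  have w: "0 < w" "w * w = a" using a0 by (auto simp: w_def)
  define c where "c = cosh (w * (L / 2))"
  have c: "0 < c" by (simp add: c_def)
  define U where "U x = (1 - cosh (w * (x - L/2)) / c) / a" for x
  define U' where "U' x = - w * sinh (w * (x - L/2)) / c / a" for x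
  have M: "M = (1 - 1 / c) / a"
  proof -
    have "sqrt (a * L\<^sup>2) / 2 = w * (L / 2)" using L by (simp add: real_sqrt_mult w_def)
    then show ?thesis using a0 L by (simp add: M_def const_landscape_max_def c_def field_simps)
  qed
  show ?thesis
  proof (rule that[of U U'])
    have "(U has_real_derivative U' x) (at x)" for x
      unfolding U_def U'_def using a0 c
      by (auto intro!: derivative_eq_intros simp: field_simps)
    moreover have "(U' has_real_derivative a * U x - 1) (at x)" for x
    proof -
      have "(U' has_real_derivative - w * (w * cosh (w * (x - L/2))) / c / a) (at x)"
        unfolding U'_def using a0 c
        by (auto intro!: derivative_eq_intros simp: field_simps)
      moreover have "- w * (w * cosh (w * (x - L/2))) / c / a = a * U x - 1"
        using a0 by (simp add: U_def w(2) flip: mult.assoc)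
      ultimately show ?thesis by simp
    qed
    ultimately show "C1_pair {} 0 L U U' (\<lambda>x. a * U x - 1)"
      unfolding C1_pair_def by (auto intro!: DERIV_isCont continuous_at_imp_continuous_on)
    show "U (L/2) = M" by (simp add: U_def M)
    have "w * (0 - L/2) = - (w * (L/2))" "w * (L - L/2) = w * (L/2)" by (simp_all add: algebra_simps)
    then have "cosh (w * (0 - L/2)) = c" "cosh (w * (L - L/2)) = c"
      unfolding c_def by (simp_all only: cosh_minus)
    then show "U 0 = 0" "U L = 0" using c unfolding U_def by simp_all
    fix x assume x: "x \<in> {0..L}"
    have "\<bar>x - L/2\<bar> \<le> \<bar>L/2\<bar>" using x L by (auto simp: abs_if)
    then have "\<bar>w * (x - L/2)\<bar> \<le> \<bar>w * (L/2)\<bar>"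
      unfolding abs_mult by (rule mult_left_mono) simp
    then have "cosh (w * (x - L/2)) \<le> c"
      unfolding c_def using cosh_real_nonneg_le_iff[of "\<bar>w * (x - L/2)\<bar>" "w * (L/2)"] w L
      by (simp add: cosh_real_abs)
    moreover have "1 \<le> cosh (w * (x - L/2))" by (rule cosh_real_ge_1)
    ultimately show "0 \<le> U x \<and> U x \<le> M"
      using a0 c unfolding U_def M by (auto intro!: divide_right_mono divide_nonneg_pos)
  qed
qed

text \<open>
  The bound \<open>12\<close> uses \<open>a M \<le> 1\<close> and \<open>M \<le> L\<^sup>2\<close>. The latter follows from
  \<open>M\<^sup>2 = U(L/2)\<^sup>2 \<le> L \<integral> U'\<^sup>2 \<le> L\<^sup>2 M\<close>, which avoids estimates for the hyperbolic cosine.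
\<close>
lemma const_ratio_bounds:
  fixes L a :: real
  assumes L: "0 < L" and a: "0 \<le> a"
  defines "M \<equiv> L\<^sup>2 * const_landscape_max (a * L\<^sup>2)"
  shows "((pi / L)\<^sup>2 + a) * M = const_ratio (a * L\<^sup>2)" and "0 \<le> M" and "const_ratio (a * L\<^sup>2) \<le> 12"
proof -
  show eq: "((pi / L)\<^sup>2 + a) * M = const_ratio (a * L\<^sup>2)"
    using L by (simp add: M_def const_ratio_def power_divide field_simps)
  obtain U U' where U: "C1_pair {} 0 L U U' (\<lambda>x. a * U x - 1)" "U 0 = 0" "U L = 0"
    "\<And>x. x \<in> {0..L} \<Longrightarrow> 0 \<le> U x \<and> U x \<le> M" "U (L/2) = M"
    using const_landscape[OF L a] unfolding M_def by blast
  note C = C1_pairD[OF U(1)]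
  show M: "0 \<le> M" using U(4)[of "L/2"] U(5) L by auto
  have "M\<^sup>2 \<le> L * integral {0..L} (\<lambda>x. (U' x)\<^sup>2)"
    using square_le_integral_derivative[OF C(1,2,3) U(2), of "L/2"] U(5) L by auto
  also have "\<dots> \<le> L * (M * L)"
    using L by (intro mult_left_mono constant_landscape_energy[OF L a U(1,2,3)])
      (use U(4) in \<open>auto simp: abs_le_iff intro: order_trans[of _ 0]\<close>)
  finally have "M * M \<le> L\<^sup>2 * M" by (simp add: power2_eq_square mult_ac)
  then have M_le: "M \<le> L\<^sup>2" using M by (cases "M = 0") auto
  have "a * M \<le> 1"
  proof (cases "a = 0")
    case False
    then have "a * M = 1 - 1 / cosh (sqrt (a * L\<^sup>2) / 2)"
      using L by (simp add: M_def const_landscape_max_def)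
    then show ?thesis by simp
  qed simp
  moreover have "(pi / L)\<^sup>2 * M \<le> (pi / L)\<^sup>2 * L\<^sup>2" by (intro mult_left_mono M_le) simp
  moreover have "(pi / L)\<^sup>2 * L\<^sup>2 = pi\<^sup>2" using L by (simp add: power_divide)
  moreover have "pi\<^sup>2 \<le> (3.2)\<^sup>2" using pi_approx by (intro power_mono) auto
  ultimately show "const_ratio (a * L\<^sup>2) \<le> 12"
    unfolding eq[symmetric] by (simp add: distrib_right power2_eq_square)
qed

lemma const_ratio_0: "const_ratio 0 = pi\<^sup>2 / 8"
  by (simp add: const_ratio_def const_landscape_max_def)

lemma const_ratio_continuous: "continuous_on {0..} const_ratio"
proof -
  have "continuous (at t within {0..}) const_landscape_max" if t: "t \<in> {0..}" for t
  proof (cases "t = 0")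
    case True
    have "((\<lambda>t::real. (1 - 1 / cosh (sqrt t / 2)) / t) \<longlongrightarrow> 1/8) (at_right 0)"
      unfolding cosh_field_def by real_asymp
    then have "(const_landscape_max \<longlongrightarrow> 1/8) (at_right 0)"
      by (rule Lim_transform_eventually)
         (auto simp: eventually_at_filter const_landscape_max_def)
    moreover have "at (0::real) within {0..} = at_right 0" by (simp add: at_within_Ici_at_right)
    ultimately show ?thesis
      using True by (simp add: continuous_within const_landscape_max_def)
  next
    case False
    then have t0: "0 < t" using t by simp
    have "isCont (\<lambda>t::real. (1 - 1 / cosh (sqrt t / 2)) / t) t"
      using t0 by (auto intro!: continuous_intros)
    moreover have "\<forall>\<^sub>F s in nhds t. const_landscape_max s = (1 - 1 / cosh (sqrt s / 2)) / s"
      using eventually_nhds_in_open[of "{0<..}" t] t0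
      by (auto elim!: eventually_mono simp: const_landscape_max_def)
    ultimately have "isCont const_landscape_max t" by (simp add: isCont_cong)
    then show ?thesis by (rule continuous_at_imp_continuous_at_within)
  qed
  then have "continuous_on {0..} const_landscape_max" by (simp add: continuous_on_eq_continuous_within)
  then show ?thesis unfolding const_ratio_def[abs_def] by (intro continuous_intros)
qed

lemma const_ratio_at_top: "(const_ratio \<longlongrightarrow> 1) at_top"
proof -
  have "((\<lambda>t. (pi\<^sup>2 + t) * ((1 - 1 / cosh (sqrt t / 2)) / t)) \<longlongrightarrow> 1) at_top"
    unfolding cosh_field_def by real_asymp
  then show ?thesis
    by (rule Lim_transform_eventually)
       (auto simp: const_ratio_def const_landscape_max_def intro!: eventually_mono[OF eventually_gt_at_top[of 0]])
qed

lemma const_ratio_attains: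
  assumes "1 < r" "r \<le> pi\<^sup>2 / 8"
  obtains t where "0 \<le> t" "const_ratio t = r"
proof -
  have "\<forall>\<^sub>F t in at_top. const_ratio t < r"
    by (rule order_tendstoD(2)[OF const_ratio_at_top assms(1)])
  then have "\<forall>\<^sub>F t in at_top. const_ratio t < r \<and> 0 \<le> t"
    using eventually_ge_at_top[of 0] by (rule eventually_conj)
  then obtain b where b: "const_ratio b < r" "0 \<le> b"
    using eventually_happens'[OF trivial_limit_at_top_linorder] by blast
  have "continuous_on {0..b} const_ratio"
    by (rule continuous_on_subset[OF const_ratio_continuous]) auto
  then obtain t where "0 \<le> t" "const_ratio t = r"
    using IVT2'[of const_ratio b r 0] b assms(2) by (auto simp: const_ratio_0)
  then show ?thesis using that by blast
qed

context averaged_potential begin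

section \<open>The eigenvalue-landscape ratio\<close>

text \<open>
  Since \<open>1 / u\<close> attains its infimum at the maximum point \<open>z\<close> of \<open>u\<close>, the ratio is \<open>E u(z)\<close>. Both
  factors are close to those for the constant potential: \<open>E\<close> within \<open>2 \<eta> A\<close> of \<open>A\<close>, and \<open>u(z)\<close> within
  \<open>25 \<eta> / A\<close> of \<open>M\<close>. As \<open>A M\<close> is bounded, the product is within a fixed multiple of \<open>\<eta>\<close> of \<open>A M\<close>.
\<close>
lemma ratio_estimate:
  "\<bar>ground_state_eigenvalue W L / min_inverse_landscape W L - const_ratio (a * L\<^sup>2)\<bar> \<le> 60 * \<eta>"
proof -
  define E where "E = ground_state_eigenvalue W L"
  define M where "M = L\<^sup>2 * const_landscape_max (a * L\<^sup>2)"
  define u where "u = landscape W L"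
  note R = const_ratio_bounds[OF L_pos a_nonneg, folded M_def, folded A_def]
  obtain U U' where U: "C1_pair {} 0 L U U' (\<lambda>x. a * U x - 1)" "U 0 = 0" "U L = 0"
    "\<And>x. x \<in> {0..L} \<Longrightarrow> 0 \<le> U x \<and> U x \<le> M" "U (L/2) = M"
    using const_landscape[OF L_pos a_nonneg] unfolding M_def by blast
  have AM: "0 \<le> A * M" "A * M \<le> 12" using mult_nonneg_nonneg[OF less_imp_le[OF A_pos] R(2)] R by auto
  \<comment> \<open>\<open>25\<close> comes from \<open>4 (12\<^sup>2 + 12) \<le> 25\<^sup>2\<close>\<close>
  define \<delta> where "\<delta> = 25 * \<eta> / A"
  have \<delta>: "0 \<le> \<delta>" using A_pos \<eta>_nonneg by (simp add: \<delta>_def)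
  have close: "\<bar>u x - U x\<bar> \<le> \<delta>" if x: "x \<in> {0..L}" for x
  proof -
    have "(u x - U x)\<^sup>2 \<le> 4 * \<eta>\<^sup>2 * (M\<^sup>2 + M / A)"
      unfolding u_def by (rule landscape_comparison[OF U(1,2,3) _ x])
        (use U(4) in \<open>auto simp: abs_le_iff intro: order_trans[of _ 0]\<close>)
    also have "M\<^sup>2 + M / A = ((A * M)\<^sup>2 + A * M) / A\<^sup>2"
      using A_pos by (simp add: power2_eq_square field_simps)
    also have "4 * \<eta>\<^sup>2 * (((A * M)\<^sup>2 + A * M) / A\<^sup>2) \<le> 4 * \<eta>\<^sup>2 * ((12\<^sup>2 + 12) / A\<^sup>2)"
      using AM by (intro mult_left_mono divide_right_mono add_mono power_mono) auto
    also have "\<dots> \<le> \<delta>\<^sup>2"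
      by (simp add: \<delta>_def power_divide power_mult_distrib divide_right_mono)
    finally show ?thesis by (rule abs_le_square_iff[THEN iffD2, of _ \<delta>, unfolded abs_of_nonneg[OF \<delta>]])
  qed
  obtain v where uv: "C1_pair S 0 L u v (\<lambda>x. W x * u x - 1)" and u0: "u 0 = 0" "u L = 0"
    unfolding u_def by (rule landscape_pair)
  have pos: "0 < u x" if "x \<in> {0<..<L}" for x
    unfolding u_def by (rule landscape_pos[OF that])
  obtain z where z: "z \<in> {0..L}" "\<And>x. x \<in> {0..L} \<Longrightarrow> u x \<le> u z"
    using continuous_attains_sup[of "{0..L}" u] C1_pairD(1)[OF uv] L_pos by auto
  have half: "L/2 \<in> {0<..<L}" "L/2 \<in> {0..L}" using L_pos by auto
  have uz: "0 < u z" using pos[OF half(1)] z(2)[OF half(2)] by linarith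
  then have z': "z \<in> {0<..<L}" using z(1) u0 by (auto simp: le_less)
  have "min_inverse_landscape W L = 1 / u z"
    unfolding min_inverse_landscape_def u_def[symmetric]
  proof (rule cInf_eq_minimum)
    show "1 / u z \<in> (\<lambda>x. 1 / u x) ` {0<..<L}" using z' by blast
    fix y assume "y \<in> (\<lambda>x. 1 / u x) ` {0<..<L}"
    then obtain x where x: "x \<in> {0<..<L}" "y = 1 / u x" by blast
    then show "1 / u z \<le> y" using pos[of x] z(2)[of x] by (auto intro!: divide_left_mono mult_pos_pos uz)
  qed
  then have ratio: "ground_state_eigenvalue W L / min_inverse_landscape W L = E * u z"
    by (simp add: E_def)
  have "u z \<le> M + \<delta>" using close[OF z(1)] U(4)[OF z(1)] by (auto simp: abs_le_iff)
  moreover have "M - \<delta> \<le> u z"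
    using close[OF half(2)] z(2)[OF half(2)] by (auto simp: U(5) abs_le_iff)
  ultimately have uM: "\<bar>u z - M\<bar> \<le> \<delta>" by (simp add: abs_le_iff)
  have A\<delta>: "A * \<delta> = 25 * \<eta>" using A_pos by (simp add: \<delta>_def)
  have "\<bar>E - A\<bar> \<le> 2 * \<eta> * A"
    using ground_state_eigenvalue_upper ground_state_eigenvalue_lower
    by (simp add: E_def abs_le_iff algebra_simps)
  then have "\<bar>E - A\<bar> * u z \<le> 2 * \<eta> * A * u z" using uz by (intro mult_right_mono) auto
  also have "\<dots> = 2 * \<eta> * (A * u z)" by simp
  also have "\<dots> \<le> 2 * \<eta> * 16"
  proof (rule mult_left_mono)
    have "A * u z \<le> A * (M + \<delta>)" using \<open>u z \<le> M + \<delta>\<close> A_pos by simp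
    also have "\<dots> = A * M + 25 * \<eta>" using A\<delta> by (simp add: distrib_left)
    finally show "A * u z \<le> 16" using AM(2) \<eta>_le by linarith
  qed (use \<eta>_nonneg in simp)
  finally have 1: "\<bar>E - A\<bar> * u z \<le> 32 * \<eta>" by simp
  have "A * \<bar>u z - M\<bar> \<le> A * \<delta>" using A_pos uM by simp
  then have 2: "A * \<bar>u z - M\<bar> \<le> 25 * \<eta>" using A\<delta> by simp
  have "E * u z - A * M = (E - A) * u z + A * (u z - M)" by (simp add: algebra_simps)
  also have "\<bar>\<dots>\<bar> \<le> \<bar>(E - A) * u z\<bar> + \<bar>A * (u z - M)\<bar>" by (rule abs_triangle_ineq)
  also have "\<dots> = \<bar>E - A\<bar> * u z + A * \<bar>u z - M\<bar>" using uz A_pos by (simp add: abs_mult)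
  also have "\<dots> \<le> 60 * \<eta>" using 1 2 \<eta>_nonneg by linarith
  finally show ?thesis unfolding ratio R(1) .
qed

end

section \<open>Sample paths of the random potential\<close>

lemma random_potential_eq: "random_potential w x = w \<lfloor>x\<rfloor>"
proof -
  have "random_potential w x = (\<Sum>\<^sub>\<infinity>j\<in>{\<lfloor>x\<rfloor>}. w j * indicator {0..<1} (x - of_int j))"
    unfolding random_potential_def
  proof (rule infsum_cong_neutral)
    fix j assume "j \<in> UNIV - {\<lfloor>x\<rfloor>}"
    then have "x - of_int j \<notin> {0..<1}" using floor_unique[of j x] by auto
    then show "w j * indicator {0..<1} (x - of_int j) = 0" by simp
  qed auto
  moreover have "x - of_int \<lfloor>x\<rfloor> \<in> {0..<1}" using floor_correct[of x] by simp linarith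
  then have "(\<Sum>\<^sub>\<infinity>j\<in>{\<lfloor>x\<rfloor>}. w j * indicator {0..<1} (x - of_int j)) = w \<lfloor>x\<rfloor>" by simp
  ultimately show ?thesis by simp
qed

lemma step_function_has_integral:
  fixes w :: "int \<Rightarrow> real"
  assumes xn: "x \<in> {real n..real n + 1}"
  shows "((\<lambda>r. w \<lfloor>r\<rfloor> - m) has_integral
    (\<Sum>j<n. w (int j)) - real n * m + (x - real n) * (w (int n) - m)) {0..x}"
proof -
  have step: "((\<lambda>r. w \<lfloor>r\<rfloor> - m) has_integral (x - real n) * (w (int n) - m)) {real n..x}"
    if x: "x \<in> {real n..real n + 1}" for n x
  proof (rule has_integral_spike_finite[where S = "{real n + 1}" and f = "\<lambda>r. w (int n) - m"])
    show "((\<lambda>r. w (int n) - m) has_integral (x - real n) * (w (int n) - m)) {real n..x}"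
      using has_integral_const_real[of "w (int n) - m" "real n" x] x by simp
    fix r assume r: "r \<in> {real n..x} - {real n + 1}"
    then have "\<lfloor>r\<rfloor> = int n" using x by (intro floor_unique) auto
    then show "w \<lfloor>r\<rfloor> - m = w (int n) - m" by simp
  qed simp
  have base: "((\<lambda>r. w \<lfloor>r\<rfloor> - m) has_integral (\<Sum>j<n. w (int j)) - real n * m) {0..real n}" for n
  proof (induction n)
    case (Suc n)
    have "((\<lambda>r. w \<lfloor>r\<rfloor> - m) has_integral
        ((\<Sum>j<n. w (int j)) - real n * m) + (real (Suc n) - real n) * (w (int n) - m)) {0..real (Suc n)}"
      by (rule has_integral_combine[OF _ _ Suc.IH step]) auto
    then show ?case by (simp add: algebra_simps)
  qed auto
  show ?thesis
    by (rule has_integral_combine[OF _ _ base step[OF xn]]) (use xn in auto)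
qed

text \<open>
  Between integers \<open>Q\<close> is affine with slope at most \<open>k C\<close>, and at the integer \<open>n\<close> it is \<open>k\<close> times the
  deviation of the \<open>n\<close>th partial sum from its mean. This explains the value of \<open>\<eta>\<close>.
\<close>
lemma ratio_estimate_for_path:
  fixes w :: "int \<Rightarrow> real" and L :: nat
  assumes w: "\<And>j. 0 \<le> w j" "\<And>j. w j \<le> C" and m: "0 \<le> m" "m \<le> C"
    and dev: "\<And>n. \<bar>(\<Sum>j<n. w (int j)) - real n * m\<bar> \<le> K + real n powr (3/4)"
    and L: "1 \<le> L" and k: "0 \<le> k"
  defines "\<eta> \<equiv> k * real L * (K + C + real L powr (3/4))"
  assumes \<eta>: "\<eta> \<le> 1/8"
  shows "\<bar>eigenvalue_landscape_ratio k w L - const_ratio (k * m * (real L)\<^sup>2)\<bar> \<le> 60 * \<eta>"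
proof -
  define W where "W x = k * random_potential w x" for x
  have W: "W x = k * w \<lfloor>x\<rfloor>" for x by (simp add: W_def random_potential_eq)
  define S :: "real set" where "S = real_of_int ` {0..int L}"
  interpret potential W "real L" "k * C" S
  proof
    show "0 < real L" using L by simp
    show "finite S" by (simp add: S_def)
    have "(\<lambda>x::real. w \<lfloor>x\<rfloor>) \<in> borel_measurable borel" by measurable
    then show "W \<in> borel_measurable borel" unfolding W[abs_def] by measurable
    show "0 \<le> W x" "W x \<le> k * C" for x
      unfolding W using k w by (auto intro: mult_left_mono)
    fix x assume x: "x \<in> {0<..<real L} - S"
    have "x \<noteq> of_int \<lfloor>x\<rfloor>"
    proof
      assume "x = of_int \<lfloor>x\<rfloor>"
      moreover have "\<lfloor>x\<rfloor> \<in> {0..int L}" using x by (auto simp: floor_le_iff)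
      ultimately have "x \<in> S" unfolding S_def by blast
      then show False using x by simp
    qed
    then have "x \<in> {of_int \<lfloor>x\<rfloor><..<of_int \<lfloor>x\<rfloor> + 1}"
      using of_int_floor_le[of x] real_of_int_floor_add_one_gt[of x] by (auto simp: less_le)
    then have "\<forall>\<^sub>F r in nhds x. r \<in> {of_int \<lfloor>x\<rfloor><..<of_int \<lfloor>x\<rfloor> + 1}"
      by (intro eventually_nhds_in_open) auto
    then have "\<forall>\<^sub>F r in nhds x. W r = k * w \<lfloor>x\<rfloor>"
    proof eventually_elim
      case (elim r)
      then have "\<lfloor>r\<rfloor> = \<lfloor>x\<rfloor>" by (intro floor_unique) auto
      then show ?case by (simp add: W)
    qed
    then show "isCont W x" by (simp add: isCont_cong)
  qed
  define Q where "Q x = integral {0..x} (\<lambda>r. (W r - k * m) * 1 + 0)" for x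
  have C: "0 \<le> C" using m by simp
  have K: "0 \<le> K" using dev[of 0] by simp
  have \<eta>0: "0 \<le> \<eta>" unfolding \<eta>_def using k K C by (intro mult_nonneg_nonneg add_nonneg_nonneg) auto
  interpret averaged_potential W "real L" "k * C" S "k * m" \<eta> Q
  proof
    show "0 \<le> k * m" using k m by simp
    show "continuous_on {0..real L} Q"
      using primitive_W(1)[of "\<lambda>_. 1" "\<lambda>_. 0" "k * m"] by (auto simp: Q_def[abs_def])
    show "(Q has_real_derivative W x - k * m) (at x)" if "x \<in> {0<..<real L} - S" for x
      using primitive_W(2)[of "\<lambda>_. 1" "\<lambda>_. 0" x "k * m"] that by (auto simp: Q_def[abs_def])
    fix x assume x: "x \<in> {0..real L}"
    define n where "n = nat \<lfloor>x\<rfloor>"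
    have n: "x \<in> {real n..real n + 1}" using x by (auto simp: n_def of_nat_nat)
    have nL: "real n \<le> real L" using x n by auto
    define F where "F = (\<Sum>j<n. w (int j)) - real n * m + (x - real n) * (w (int n) - m)"
    have "((\<lambda>r. k * (w \<lfloor>r\<rfloor> - m)) has_integral k * F) {0..x}"
      unfolding F_def by (intro has_integral_mult_right step_function_has_integral n)
    then have Q: "Q x = k * F"
      by (auto simp: Q_def W algebra_simps dest: integral_unique)
    have "\<bar>(x - real n) * (w (int n) - m)\<bar> \<le> 1 * C"
      unfolding abs_mult using n w[of "int n"] m by (intro mult_mono) auto
    moreover have "real n powr (3/4) \<le> real L powr (3/4)" using nL by (intro powr_mono2) auto
    ultimately have "\<bar>F\<bar> \<le> K + C + real L powr (3/4)"
      using dev[of n] unfolding F_def by linarith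
    then have "\<bar>Q x\<bar> \<le> k * (K + C + real L powr (3/4))"
      unfolding Q using k by (simp add: abs_mult mult_left_mono)
    also have "\<dots> = \<eta> / real L" using L by (simp add: \<eta>_def)
    finally show "\<bar>Q x\<bar> \<le> \<eta> / real L" .
  qed (use \<eta> \<eta>0 in auto)
  have "eigenvalue_landscape_ratio k w L = ground_state_eigenvalue W (real L) / min_inverse_landscape W (real L)"
    by (simp add: eigenvalue_landscape_ratio_def W_def[abs_def] Let_def)
  then show ?thesis using ratio_estimate by simp
qed

lemma ratio_tendsto_for_path:
  fixes w :: "int \<Rightarrow> real" and k :: "nat \<Rightarrow> real"
  assumes w: "\<And>j. 0 \<le> w j" "\<And>j. w j \<le> C" and m: "0 \<le> m" "m \<le> C"
    and dev: "\<And>n. \<bar>(\<Sum>j<n. w (int j)) - real n * m\<bar> \<le> K + real n powr (3/4)"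
    and k: "\<And>L. 1 \<le> L \<Longrightarrow> 0 \<le> k L"
    and small: "(\<lambda>L. k L * real L powr (7/4)) \<longlonglongrightarrow> 0"
    and lim: "(\<lambda>L. const_ratio (k L * m * (real L)\<^sup>2)) \<longlonglongrightarrow> \<rho>"
  shows "(\<lambda>L. eigenvalue_landscape_ratio (k L) w L) \<longlonglongrightarrow> \<rho>"
proof -
  define \<eta> where "\<eta> L = k L * real L * (K + C + real L powr (3/4))" for L
  have lim0: "(\<lambda>L. (k L * real L powr (7/4)) * ((K + C) * real L powr (-3/4) + 1)) \<longlonglongrightarrow> 0 * ((K + C) * 0 + 1)"
    by (intro tendsto_intros small) real_asymp
  have rearrange: "c * (l * p) * (d * q + 1) = c * l * (d * (p * q) + p)" for c l p d q :: real
    by algebra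
  have "\<forall>\<^sub>F L in sequentially. (k L * real L powr (7/4)) * ((K + C) * real L powr (-3/4) + 1) = \<eta> L"
    using eventually_ge_at_top[of 1]
  proof eventually_elim
    case (elim L)
    have p: "real L powr (7/4) = real L * real L powr (3/4)"
      using powr_add[of "real L" 1 "3/4"] elim by simp
    have q: "real L powr (3/4) * real L powr (-3/4) = 1"
      using powr_add[of "real L" "3/4" "-3/4"] elim by simp
    have "(k L * real L powr (7/4)) * ((K + C) * real L powr (-3/4) + 1)
        = k L * real L * ((K + C) * (real L powr (3/4) * real L powr (-3/4)) + real L powr (3/4))"
      unfolding p by (rule rearrange)
    then show ?case unfolding q mult_1_right \<eta>_def .
  qed
  from Lim_transform_eventually[OF lim0 this] have \<eta>: "\<eta> \<longlonglongrightarrow> 0" by simp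
  then have small': "\<forall>\<^sub>F L in sequentially. \<eta> L \<le> 1/8"
    by (intro eventually_mono[OF order_tendstoD(2)[OF \<eta>, of "1/8"]]) auto
  have "(\<lambda>L. eigenvalue_landscape_ratio (k L) w L - const_ratio (k L * m * (real L)\<^sup>2)) \<longlonglongrightarrow> 0"
  proof (rule Lim_null_comparison)
    show "(\<lambda>L. 60 * \<eta> L) \<longlonglongrightarrow> 0" using tendsto_mult_left[OF \<eta>, of 60] by simp
    show "\<forall>\<^sub>F L in sequentially.
        norm (eigenvalue_landscape_ratio (k L) w L - const_ratio (k L * m * (real L)\<^sup>2)) \<le> 60 * \<eta> L"
      using eventually_ge_at_top[of 1] small'
    proof eventually_elim
      case (elim L)
      show ?case
        using ratio_estimate_for_path[OF w m dev elim(1) k[OF elim(1)]] elim(2)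
        unfolding \<eta>_def by simp
    qed
  qed
  from tendsto_add[OF this lim] show ?thesis by simp
qed

section \<open>Almost sure limits\<close>

text \<open>
  By Hoeffding's inequality the probability of a deviation beyond \<open>n\<^bsup>3/4\<^esup>\<close> is at most
  \<open>2 exp (- 2 sqrt n / C\<^sup>2)\<close>, which is summable, so almost surely only finitely many such deviations
  occur. The constant \<open>K\<close> accounts for these.
\<close>
lemma partial_sums_deviation:
  fixes M :: "'a measure" and \<omega> :: "int \<Rightarrow> 'a \<Rightarrow> real"
  assumes "prob_space M"
    and indep: "prob_space.indep_vars M (\<lambda>_. borel) \<omega> UNIV"
    and mean: "\<And>j. prob_space.expectation M (\<omega> j) = m"
    and bounds: "\<And>j. AE s in M. \<omega> j s \<in> {0..C}" and C: "0 < C"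
  shows "AE s in M. \<exists>K. \<forall>n. \<bar>(\<Sum>j<n. \<omega> (int j) s) - real n * m\<bar> \<le> K + real n powr (3/4)"
proof -
  interpret prob_space M by fact
  have [measurable]: "\<omega> j \<in> borel_measurable M" for j
    using indep by (auto simp: indep_vars_def)
  define D where "D n s = \<bar>(\<Sum>j<n. \<omega> (int j) s) - real n * m\<bar>" for n s
  define bad where "bad n = {s \<in> space M. real n powr (3/4) \<le> D n s}" for n
  have bad_sets [measurable]: "bad n \<in> sets M" for n unfolding bad_def D_def by measurable
  have prob_bad: "prob (bad n) \<le> 2 * exp (- (2 / C\<^sup>2) * sqrt (real n))" if n: "1 \<le> n" for n
  proof -
    interpret Hoeffding_ineq M "{0..<int n}" \<omega> "\<lambda>_. 0" "\<lambda>_. C" "\<Sum>i\<in>{0..<int n}. expectation (\<omega> i)"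
    proof unfold_locales
      show "indep_vars (\<lambda>_. borel) \<omega> {0..<int n}" by (rule indep_vars_subset[OF indep]) simp
    qed (simp_all add: bounds del: atLeastAtMost_iff)
    have sum_eq: "(\<Sum>i\<in>{0..<int n}. f i) = (\<Sum>j<n. f (int j))" for f :: "int \<Rightarrow> real"
      by (rule sum.reindex_bij_witness[of _ int nat]) auto
    have pow: "(real n powr (3/4))\<^sup>2 = real n * sqrt (real n)"
    proof -
      have "(real n powr (3/4))\<^sup>2 = real n powr (3/4 + 3/4)"
        by (simp only: power2_eq_square powr_add)
      also have "\<dots> = real n powr (1 + 1/2)" by simp
      also have "\<dots> = real n * sqrt (real n)" using n by (simp only: powr_add) (simp add: powr_half_sqrt)
      finally show ?thesis .
    qed
    have "prob {s \<in> space M. real n powr (3/4) \<le> \<bar>(\<Sum>i\<in>{0..<int n}. \<omega> i s) - (\<Sum>i\<in>{0..<int n}. expectation (\<omega> i))\<bar>}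
        \<le> 2 * exp (- 2 * (real n powr (3/4))\<^sup>2 / (\<Sum>i\<in>{0..<int n}. (C - 0)\<^sup>2))"
      by (rule Hoeffding_ineq_abs_ge) (use n C in auto)
    also have "{s \<in> space M. real n powr (3/4) \<le> \<bar>(\<Sum>i\<in>{0..<int n}. \<omega> i s) - (\<Sum>i\<in>{0..<int n}. expectation (\<omega> i))\<bar>} = bad n"
      by (simp add: bad_def D_def sum_eq mean)
    also have "- 2 * (real n powr (3/4))\<^sup>2 / (\<Sum>i\<in>{0..<int n}. (C - 0)\<^sup>2) = - (2 / C\<^sup>2) * sqrt (real n)"
      unfolding pow using n C by simp
    finally show ?thesis .
  qed
  have "AE s in M. \<forall>\<^sub>F n in sequentially. s \<in> space M - bad n"
  proof (rule borel_cantelli_AE1)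
    have "(\<lambda>n. 2 * exp (- c * sqrt (real n))) \<in> O(\<lambda>n. 1 / real n ^ 2)" if "0 < c" for c :: real
      using that by real_asymp
    from this[of "2 / C\<^sup>2"] have O: "(\<lambda>n. 2 * exp (- (2 / C\<^sup>2) * sqrt (real n))) \<in> O(\<lambda>n. 1 / real n ^ 2)"
      using C by simp
    have "summable (\<lambda>n. norm (1 / real n ^ 2))"
      using inverse_power_summable[of 2, where 'a = real] by (simp add: divide_inverse)
    then have "summable (\<lambda>n. 2 * exp (- (2 / C\<^sup>2) * sqrt (real n)))"
      using O by (rule summable_comparison_test_bigo)
    then show "summable (\<lambda>n. prob (bad n))"
      by (rule summable_comparison_test'[of _ 1]) (use prob_bad in auto)
  qed (auto simp: emeasure_eq_measure)
  then show ?thesis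
  proof eventually_elim
    case (elim s)
    then obtain N where N: "\<And>n. n \<ge> N \<Longrightarrow> s \<in> space M - bad n"
      by (auto simp: eventually_sequentially)
    have "D n s \<le> (\<Sum>i<N. D i s) + real n powr (3/4)" for n
    proof (cases "n < N")
      case True
      have "D n s \<le> (\<Sum>i<N. D i s)"
        by (rule member_le_sum) (use True in \<open>auto simp: D_def\<close>)
      then show ?thesis using powr_ge_zero[of "real n" "3/4"] by linarith
    next
      case False
      then have "D n s \<le> real n powr (3/4)" using N[of n] by (auto simp: bad_def)
      moreover have "0 \<le> (\<Sum>i<N. D i s)" by (intro sum_nonneg) (simp add: D_def)
      ultimately show ?thesis by linarith
    qed
    then show ?case unfolding D_def by blast
  qed
qed

text \<open>
  The form in which the probabilistic input is used: given \<open>k L\<^bsup>7/4\<^esup> \<longlonglongrightarrow> 0\<close>, the ratio inherits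
  the limit of the ratio for the averaged potential.
\<close>
lemma almost_sure_ratio_limit:
  fixes M :: "'a measure" and \<omega> :: "int \<Rightarrow> 'a \<Rightarrow> real" and X :: "'a \<Rightarrow> real"
  assumes M: "prob_space M"
    and indep: "prob_space.indep_vars M (\<lambda>_. borel) \<omega> UNIV"
    and X: "X \<in> borel_measurable M"
    and dist: "\<And>j. distr M borel (\<omega> j) = distr M borel X"
    and nonneg: "AE s in M. 0 \<le> X s"
    and bounded: "\<exists>C. AE s in M. X s \<le> C"
    and k: "\<And>L. 1 \<le> L \<Longrightarrow> 0 \<le> k L"
    and small: "(\<lambda>L. k L * real L powr (7/4)) \<longlonglongrightarrow> 0"
    and lim: "(\<lambda>L. const_ratio (k L * prob_space.expectation M X * (real L)\<^sup>2)) \<longlonglongrightarrow> \<rho>"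
  shows "AE s in M. (\<lambda>L. eigenvalue_landscape_ratio (k L) (\<lambda>j. \<omega> j s) L) \<longlonglongrightarrow> \<rho>"
proof -
  interpret prob_space M by fact
  have meas: "\<omega> j \<in> borel_measurable M" for j
    using indep by (auto simp: indep_vars_def)
  obtain C0 where C0: "AE s in M. X s \<le> C0" using bounded by blast
  \<comment> \<open>a positive bound, so that the interval in Hoeffding's inequality is nondegenerate\<close>
  define C where "C = max C0 1"
  have XC: "AE s in M. X s \<in> {0..C}"
    using nonneg C0 by eventually_elim (auto simp: C_def)
  have bounds: "AE s in M. \<omega> j s \<in> {0..C}" for j
  proof -
    have "AE x in distr M borel (\<omega> j). x \<in> {0..C}"
      unfolding dist using XC by (subst AE_distr_iff[OF X]) auto
    then show ?thesis by (subst (asm) AE_distr_iff[OF meas]) auto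
  qed
  have mean: "expectation (\<omega> j) = expectation X" for j
  proof -
    have "expectation (\<omega> j) = (\<integral>x. x \<partial>distr M borel (\<omega> j))"
      by (rule integral_distr[symmetric, OF meas]) simp
    also have "\<dots> = expectation X" unfolding dist by (rule integral_distr[OF X]) simp
    finally show ?thesis .
  qed
  have intX: "integrable M X"
    by (rule integrable_const_bound[of X C]) (use XC X in auto)
  have m: "0 \<le> expectation X" "expectation X \<le> C"
    using XC by (auto intro!: integral_nonneg_AE integral_le_const[OF intX])
  have "AE s in M. \<forall>j. \<omega> j s \<in> {0..C}"
    using bounds by (simp add: AE_all_countable)
  moreover have "AE s in M. \<exists>K. \<forall>n. \<bar>(\<Sum>j<n. \<omega> (int j) s) - real n * expectation X\<bar> \<le> K + real n powr (3/4)"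
    by (rule partial_sums_deviation[OF M indep mean bounds]) (simp add: C_def)
  ultimately show ?thesis
  proof eventually_elim
    case (elim s)
    then obtain K where "\<And>n. \<bar>(\<Sum>j<n. \<omega> (int j) s) - real n * expectation X\<bar> \<le> K + real n powr (3/4)"
      by blast
    then show ?case
      using elim(1) m by (intro ratio_tendsto_for_path[OF _ _ _ _ _ k small lim]) auto
  qed
qed

theorem theorem4:
  fixes M :: "'a measure" and \<omega> :: "int \<Rightarrow> 'a \<Rightarrow> real" and X :: "'a \<Rightarrow> real"
  assumes "prob_space M"
    and "prob_space.indep_vars M (\<lambda>_. borel) \<omega> UNIV"
    and "X \<in> borel_measurable M"
    and "\<And>j. distr M borel (\<omega> j) = distr M borel X"
    and "AE s in M. 0 \<le> X s"
    and "\<exists>C. AE s in M. X s \<le> C"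
    and "prob_space.expectation M X > 0"
  shows "(\<forall>r\<in>{1..pi\<^sup>2 / 8}. \<exists>k :: nat \<Rightarrow> real. (\<forall>L\<ge>1. 0 \<le> k L) \<and>
            (AE s in M. (\<lambda>L. eigenvalue_landscape_ratio (k L) (\<lambda>j. \<omega> j s) L) \<longlonglongrightarrow> r)) \<and>
         (\<forall>k :: nat \<Rightarrow> real. (\<forall>L\<ge>1. 0 \<le> k L) \<longrightarrow>
            (\<lambda>L. k L * real L ^ 2) \<longlonglongrightarrow> 0 \<longrightarrow>
            (AE s in M. (\<lambda>L. eigenvalue_landscape_ratio (k L) (\<lambda>j. \<omega> j s) L) \<longlonglongrightarrow> pi\<^sup>2 / 8)) \<and>
         (\<forall>(k :: nat \<Rightarrow> real) (\<beta> :: real). (\<forall>L\<ge>1. 0 \<le> k L) \<longrightarrow>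
            0 < \<beta> \<longrightarrow> \<beta> < 1 / 4 \<longrightarrow>
            filterlim (\<lambda>L. k L * real L ^ 2) at_top sequentially \<longrightarrow>
            limsup (\<lambda>L. ereal (k L * real L powr (2 - \<beta>))) < \<infinity> \<longrightarrow>
            (AE s in M. (\<lambda>L. eigenvalue_landscape_ratio (k L) (\<lambda>j. \<omega> j s) L) \<longlonglongrightarrow> 1))"
proof (intro conjI allI impI ballI)
  let ?m = "prob_space.expectation M X"
  note limit = almost_sure_ratio_limit[OF assms(1-6)]
  have m: "0 < ?m" by (rule assms(7))
  have growing: "AE s in M. (\<lambda>L. eigenvalue_landscape_ratio (k L) (\<lambda>j. \<omega> j s) L) \<longlonglongrightarrow> 1"
    if k: "\<And>L. 1 \<le> L \<Longrightarrow> 0 \<le> k L" and b: "b < 1/4"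
      and inf: "filterlim (\<lambda>L. k L * real L ^ 2) at_top sequentially"
      and le: "\<forall>\<^sub>F L in sequentially. k L * real L powr (2 - b) \<le> c"
    for k :: "nat \<Rightarrow> real" and b c
  proof (rule limit[OF k])
    have "(\<lambda>L. c * real L powr (b - 1/4)) \<longlonglongrightarrow> c * 0"
      by (intro tendsto_intros tendsto_neg_powr filterlim_real_sequentially) (use b in auto)
    then have to0: "(\<lambda>L. c * real L powr (b - 1/4)) \<longlonglongrightarrow> 0" by simp
    show "(\<lambda>L. k L * real L powr (7/4)) \<longlonglongrightarrow> 0"
    proof (rule Lim_null_comparison[OF _ to0])
      show "\<forall>\<^sub>F L in sequentially. norm (k L * real L powr (7/4)) \<le> c * real L powr (b - 1/4)"
        using le eventually_ge_at_top[of 1]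
      proof eventually_elim
        case (elim L)
        have "norm (k L * real L powr (7/4)) = k L * real L powr ((2 - b) + (b - 1/4))"
          using k[OF elim(2)] by simp
        also have "\<dots> = k L * real L powr (2 - b) * real L powr (b - 1/4)"
          by (simp only: powr_add mult.assoc)
        also have "\<dots> \<le> c * real L powr (b - 1/4)" by (intro mult_right_mono elim) simp
        finally show ?case .
      qed
    qed
    have "filterlim (\<lambda>L. ?m * (k L * real L ^ 2)) at_top sequentially"
      by (rule filterlim_tendsto_pos_mult_at_top[OF tendsto_const m inf])
    then have "filterlim (\<lambda>L. k L * ?m * (real L)\<^sup>2) at_top sequentially"
      by (simp add: mult_ac)
    then show "(\<lambda>L. const_ratio (k L * ?m * (real L)\<^sup>2)) \<longlonglongrightarrow> 1"
      by (rule filterlim_compose[OF const_ratio_at_top])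
  qed
  have bounded: "AE s in M. (\<lambda>L. eigenvalue_landscape_ratio (k L) (\<lambda>j. \<omega> j s) L) \<longlonglongrightarrow> const_ratio (t * ?m)"
    if k: "\<And>L. 1 \<le> L \<Longrightarrow> 0 \<le> k L" and t: "0 \<le> t" and lim: "(\<lambda>L. k L * real L ^ 2) \<longlonglongrightarrow> t"
    for k :: "nat \<Rightarrow> real" and t
  proof (rule limit[OF k])
    have "(\<lambda>L. (k L * real L ^ 2) * real L powr (- 1/4)) \<longlonglongrightarrow> t * 0"
      by (intro tendsto_intros lim) real_asymp
    moreover have "\<forall>\<^sub>F L in sequentially. (k L * real L ^ 2) * real L powr (- 1/4) = k L * real L powr (7/4)"
      using eventually_ge_at_top[of 1]
    proof eventually_elim
      case (elim L)
      then have "real L powr (7/4) = real L powr 2 * real L powr (- 1/4)" 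
        using powr_add[of "real L" 2 "- 1/4"] by simp
      then show ?case using elim by simp
    qed
    ultimately show "(\<lambda>L. k L * real L powr (7/4)) \<longlonglongrightarrow> 0"
      by (simp add: Lim_transform_eventually)
    have "(\<lambda>L. (k L * real L ^ 2) * ?m) \<longlonglongrightarrow> t * ?m" by (intro tendsto_intros lim)
    then have "(\<lambda>L. k L * ?m * (real L)\<^sup>2) \<longlonglongrightarrow> t * ?m" by (simp add: mult_ac)
    moreover have "\<forall>\<^sub>F L in sequentially. k L * ?m * (real L)\<^sup>2 \<in> {0..}"
      using eventually_ge_at_top[of 1] by eventually_elim (use k m in auto)
    ultimately show "(\<lambda>L. const_ratio (k L * ?m * (real L)\<^sup>2)) \<longlonglongrightarrow> const_ratio (t * ?m)"
      using t m by (intro continuous_on_tendsto_compose[OF const_ratio_continuous]) auto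
  qed
  {
    fix r :: real assume r: "r \<in> {1..pi\<^sup>2 / 8}"
    show "\<exists>k :: nat \<Rightarrow> real. (\<forall>L\<ge>1. 0 \<le> k L) \<and>
            (AE s in M. (\<lambda>L. eigenvalue_landscape_ratio (k L) (\<lambda>j. \<omega> j s) L) \<longlonglongrightarrow> r)"
    proof (cases "r = 1")
      case True
      \<comment> \<open>\<open>R\<close> need not attain the value \<open>1\<close>; the choice \<open>k L\<^sup>2 = L\<^bsup>1/8\<^esup>\<close> falls under the third regime\<close>
      define k where "k L = real L powr (- 15/8)" for L
      have "AE s in M. (\<lambda>L. eigenvalue_landscape_ratio (k L) (\<lambda>j. \<omega> j s) L) \<longlonglongrightarrow> 1"
      proof (rule growing[where b = "1/8" and c = 1])
        show "filterlim (\<lambda>L. k L * real L ^ 2) at_top sequentially" unfolding k_def by real_asymp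
        show "\<forall>\<^sub>F L in sequentially. k L * real L powr (2 - 1/8) \<le> 1"
          using eventually_ge_at_top[of 1]
          by eventually_elim (simp add: k_def flip: powr_add)
      qed (auto simp: k_def)
      then show ?thesis unfolding True by (intro exI[of _ k]) (simp add: k_def)
    next
      case False
      then obtain t where t: "0 \<le> t" "const_ratio t = r" using const_ratio_attains[of r] r by auto
      \<comment> \<open>then \<open>a L\<^sup>2\<close> equals \<open>t\<close> for every \<open>L\<close>\<close>
      define k where "k L = t / ?m / (real L)\<^sup>2" for L :: nat
      have k: "0 \<le> k L" for L using t m by (simp add: k_def)
      have "\<forall>\<^sub>F L in sequentially. k L * real L ^ 2 = t / ?m"
        using eventually_ge_at_top[of 1] by eventually_elim (simp add: k_def)
      then have "(\<lambda>L. k L * real L ^ 2) \<longlonglongrightarrow> t / ?m" by (rule tendsto_eventually)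
      from bounded[OF k _ this] have "AE s in M. (\<lambda>L. eigenvalue_landscape_ratio (k L) (\<lambda>j. \<omega> j s) L) \<longlonglongrightarrow> r"
        using t m by simp
      then show ?thesis using k by blast
    qed
  }
  {
    fix k :: "nat \<Rightarrow> real" assume "\<forall>L\<ge>1. 0 \<le> k L" "(\<lambda>L. k L * real L ^ 2) \<longlonglongrightarrow> 0"
    then show "AE s in M. (\<lambda>L. eigenvalue_landscape_ratio (k L) (\<lambda>j. \<omega> j s) L) \<longlonglongrightarrow> pi\<^sup>2 / 8"
      using bounded[of k 0] by (simp add: const_ratio_0)
  }
  {
    fix k :: "nat \<Rightarrow> real" and \<beta> :: real
    assume k: "\<forall>L\<ge>1. 0 \<le> k L" and \<beta>: "0 < \<beta>" "\<beta> < 1 / 4"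
      and inf: "filterlim (\<lambda>L. k L * real L ^ 2) at_top sequentially"
      and sup: "limsup (\<lambda>L. ereal (k L * real L powr (2 - \<beta>))) < \<infinity>"
    obtain c where "limsup (\<lambda>L. ereal (k L * real L powr (2 - \<beta>))) < ereal c"
      using less_PInf_Ex_of_nat sup by force
    then have "\<forall>\<^sub>F L in sequentially. k L * real L powr (2 - \<beta>) \<le> c"
      by (intro eventually_mono[OF Limsup_lessD]) auto
    then show "AE s in M. (\<lambda>L. eigenvalue_landscape_ratio (k L) (\<lambda>j. \<omega> j s) L) \<longlonglongrightarrow> 1"
      using growing[OF _ \<beta>(2) inf] k by blast
  }
qed

end
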